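(* Let $d$ and $R$ be fixed and let $G=(V,E)$ be a random $d$-regular graph with $n$ vertices. Then for all $\varepsilon>0$, with probability exponentially close to $1$ as $n\to\infty$, every state $|\psi\rangle$ prepared by a $\mathbf Z_2$-symmetric range-$R$ quantum circuit such that $\langle\psi|Z_{e_0}Z_{e_1}|\psi\rangle\in\{0,-1\}$ for all $e=\{e_0,e_1\}\in E$ satisfies $$\langle\psi|\sum_{e=\{e_0,e_1\}\in E}\frac{1-Z_{e_0}Z_{e_1}}{2}|\psi\rangle\ \le\ |E|\left(\frac12+\frac1d+\varepsilon\right).$$
   Context: A random $d$-regular graph is uniform among $d$-regular graphs on $n$ vertices. Qubits are labelled by the vertices of $G$. A circuit (unitary) $U$ has range $R$ with respect to $G$ if for every vertex $v$ and every single-qubit observable $\mathcal O_v$ supported on $v$, $U^\dagger\mathcal O_vU$ is supported on the set $B_G(v,R)$ of vertices at distance at most $R$ from $v$. A state $|\phi\rangle$ on $n$ qubits is $\mathbf Z_2$-symmetric if $X^{\otimes n}|\phi\rangle=|\phi\rangle$; a unitary $U$ is $\mathbf Z_2$-symmetric if $X^{\otimes n}UX^{\otimes n}=U$. A state is prepared by a $\mathbf Z_2$-symmetric range-$R$ circuit if it equals $U|\phi\rangle$ with $U$ a $\mathbf Z_2$-symmetric range-$R$ circuit and $|\phi\rangle$ a $\mathbf Z_2$-symmetric product state. "With probability exponentially close to $1$" means with probability at least $1-Ce^{-cn}$ for some constants $C,c>0$ not depending on $n$. *)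

theory Defs
  imports
    "HOL-Probability.Probability_Mass_Function"
    "HOL-Library.Extended_Nat"
    "Jordan_Normal_Form.Schur_Decomposition"
begin

unbundle no vec_syntax
unbundle no inner_syntax
hide_const (open) Finite_Cartesian_Product.vec Finite_Cartesian_Product.mat

section \<open>Graphs\<close>

text \<open>A simple graph with vertex set \<open>{..<n}\<close> is given by its set of edges, each edge being a
  two-element set of vertices.\<close>

definition simple_graph :: "nat \<Rightarrow> nat set set \<Rightarrow> bool" where
  "simple_graph n E \<longleftrightarrow> (\<forall>e\<in>E. e \<subseteq> {..<n} \<and> card e = 2)"

definition vertex_degree :: "nat set set \<Rightarrow> nat \<Rightarrow> nat" where
  "vertex_degree E v = card {e \<in> E. v \<in> e}"

definition regular_graphs :: "nat \<Rightarrow> nat \<Rightarrow> nat set set set" where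
  "regular_graphs n d = {E. simple_graph n E \<and> (\<forall>v<n. vertex_degree E v = d)}"

text \<open>The law of a uniformly random regular graph. It is meaningful only if such a graph exists,
  that is if \<open>regular_graphs n d \<noteq> {}\<close>.\<close>

definition random_regular_graph :: "nat \<Rightarrow> nat \<Rightarrow> nat set set pmf" where
  "random_regular_graph n d = pmf_of_set (regular_graphs n d)"

definition adjacency :: "nat set set \<Rightarrow> nat rel" where
  "adjacency E = {(u, v). {u, v} \<in> E}"

text \<open>The distance is the least length of a walk, and \<open>\<infinity>\<close> if there is none.\<close>

definition graph_dist :: "nat set set \<Rightarrow> nat \<Rightarrow> nat \<Rightarrow> enat" where
  "graph_dist E u v = (INF k \<in> {k. (u, v) \<in> adjacency E ^^ k}. enat k)"

definition graph_ball :: "nat \<Rightarrow> nat set set \<Rightarrow> nat \<Rightarrow> nat \<Rightarrow> nat set" where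
  "graph_ball n E v r = {w. w < n \<and> graph_dist E v w \<le> enat r}"

section \<open>Qubits\<close>

text \<open>The space of \<open>n\<close> qubits is \<open>carrier_vec (2 ^ n)\<close>. The computational basis vector number \<open>i\<close>
  has qubit \<open>v\<close> in the state given by the binary digit \<open>bit i v\<close>; thus the qubits are labelled by
  the vertices \<open>{..<n}\<close>.\<close>

definition digit :: "nat \<Rightarrow> nat \<Rightarrow> nat" where
  "digit i v = of_bool (bit i v)"

definition tensor_vec :: "nat \<Rightarrow> (nat \<Rightarrow> complex vec) \<Rightarrow> complex vec" where
  "tensor_vec n \<phi> = vec (2 ^ n) (\<lambda>i. \<Prod>v<n. \<phi> v $ digit i v)"

definition tensor_mat :: "nat \<Rightarrow> (nat \<Rightarrow> complex mat) \<Rightarrow> complex mat" where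
  "tensor_mat n A = mat (2 ^ n) (2 ^ n) (\<lambda>(i, j). \<Prod>v<n. A v $$ (digit i v, digit j v))"

definition on_qubit :: "nat \<Rightarrow> nat \<Rightarrow> complex mat \<Rightarrow> complex mat" where
  "on_qubit n v A = tensor_mat n ((\<lambda>_. 1\<^sub>m 2)(v := A))"

definition pauli_X :: "complex mat" where
  "pauli_X = mat_of_rows_list 2 [[0, 1], [1, 0]]"

definition pauli_Z :: "complex mat" where
  "pauli_Z = mat_of_rows_list 2 [[1, 0], [0, - 1]]"

definition global_X :: "nat \<Rightarrow> complex mat" where
  "global_X n = tensor_mat n (\<lambda>_. pauli_X)"

definition is_product_state :: "nat \<Rightarrow> complex vec \<Rightarrow> bool" where
  "is_product_state n \<psi> \<longleftrightarrow>
     (\<exists>\<phi>. (\<forall>v<n. \<phi> v \<in> carrier_vec 2 \<and> \<phi> v \<bullet>c \<phi> v = 1) \<and> \<psi> = tensor_vec n \<phi>)"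

definition is_unitary :: "nat \<Rightarrow> complex mat \<Rightarrow> bool" where
  "is_unitary n U \<longleftrightarrow> U \<in> carrier_mat (2 ^ n) (2 ^ n) \<and>
     mat_adjoint U * U = 1\<^sub>m (2 ^ n) \<and> U * mat_adjoint U = 1\<^sub>m (2 ^ n)"

definition is_qubit_observable :: "complex mat \<Rightarrow> bool" where
  "is_qubit_observable A \<longleftrightarrow> A \<in> carrier_mat 2 2 \<and> mat_adjoint A = A"

text \<open>An operator is supported on \<open>S\<close> if it is the tensor product of an operator on the qubits in
  \<open>S\<close> and of the identity on the remaining qubits. The matrix \<open>a\<close> of the former is indexed by
  configurations of the qubits in \<open>S\<close>, given as the sets of those qubits whose digit is \<open>1\<close>.\<close>

definition supported_on :: "nat \<Rightarrow> complex mat \<Rightarrow> nat set \<Rightarrow> bool" where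
  "supported_on n A S \<longleftrightarrow> A \<in> carrier_mat (2 ^ n) (2 ^ n) \<and>
     (\<exists>a :: nat set \<Rightarrow> nat set \<Rightarrow> complex. \<forall>i<2 ^ n. \<forall>j<2 ^ n.
        A $$ (i, j) =
          a {v \<in> S. bit i v} {v \<in> S. bit j v} *
          of_bool (\<forall>v \<in> {..<n} - S. bit i v = bit j v))"

definition has_range :: "nat \<Rightarrow> nat set set \<Rightarrow> nat \<Rightarrow> complex mat \<Rightarrow> bool" where
  "has_range n E r U \<longleftrightarrow>
     (\<forall>v<n. \<forall>A. is_qubit_observable A \<longrightarrow>
        supported_on n (mat_adjoint U * on_qubit n v A * U) (graph_ball n E v r))"

definition symmetric_state :: "nat \<Rightarrow> complex vec \<Rightarrow> bool" where
  "symmetric_state n \<psi> \<longleftrightarrow> global_X n *\<^sub>v \<psi> = \<psi>"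

definition symmetric_unitary :: "nat \<Rightarrow> complex mat \<Rightarrow> bool" where
  "symmetric_unitary n U \<longleftrightarrow> global_X n * U * global_X n = U"

definition symmetrically_prepared :: "nat \<Rightarrow> nat set set \<Rightarrow> nat \<Rightarrow> complex vec \<Rightarrow> bool" where
  "symmetrically_prepared n E r \<psi> \<longleftrightarrow>
     (\<exists>U \<phi>. is_unitary n U \<and> symmetric_unitary n U \<and> has_range n E r U \<and>
        is_product_state n \<phi> \<and> symmetric_state n \<phi> \<and> \<psi> = U *\<^sub>v \<phi>)"

definition expectation_value :: "complex mat \<Rightarrow> complex vec \<Rightarrow> complex" where
  "expectation_value A \<psi> = (A *\<^sub>v \<psi>) \<bullet>c \<psi>"

text \<open>The two endpoints of an edge \<open>e\<close> are \<open>Min e\<close> and \<open>Max e\<close>.\<close>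

definition edge_ZZ :: "nat \<Rightarrow> nat set \<Rightarrow> complex mat" where
  "edge_ZZ n e = on_qubit n (Min e) pauli_Z * on_qubit n (Max e) pauli_Z"

text \<open>Matrices of unspecified dimension form no additive monoid, so the sum over the edges is
  written entrywise.\<close>

definition maxcut_hamiltonian :: "nat \<Rightarrow> nat set set \<Rightarrow> complex mat" where
  "maxcut_hamiltonian n E =
     mat (2 ^ n) (2 ^ n) (\<lambda>ij. \<Sum>e\<in>E. ((1 / 2) \<cdot>\<^sub>m (1\<^sub>m (2 ^ n) - edge_ZZ n e)) $$ ij)"

end

theory Submission
  imports Defs
begin

text \<open>Let \<open>F\<close> be the set of edges with correlation \<open>- 1\<close>; the energy is \<open>\<bar>E\<bar> / 2 + \<bar>F\<bar> / 2\<close>. On the support of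
  the state in the computational basis, adjacent vertices of \<open>F\<close> carry opposite digits, so any two
  vertices in one component of \<open>F\<close> have correlation \<open>1\<close> or \<open>- 1\<close>. But correlations between vertices
  with disjoint light cones factorize, and vanish because the symmetry forces every single \<open>Z\<close> to have
  expectation \<open>0\<close>. Hence the components of \<open>F\<close> have diameter at most \<open>2 R\<close> in the graph, thus bounded
  size, and every cycle of \<open>F\<close> is short. Removing the edges on short cycles leaves a forest, with at
  most \<open>n\<close> edges.

  It remains to see that, outside an exponentially small probability, at most \<open>\<delta> n\<close> edges lie on
  short cycles. Replace an edge \<open>{a, b}\<close> on a short cycle and a remote edge \<open>{c, h}\<close> by \<open>{a, c}\<close> and
  \<open>{b, h}\<close>. A graph with at least \<open>\<delta> n\<close> edges on short cycles admits of order \<open>n\<^sup>2\<close> such switchings, but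
  only \<open>O(n)\<close> of them lead to any given graph, since \<open>b\<close> remains close to \<open>a\<close>. As a switching changes
  the number \<open>Y\<close> of edges on short cycles by a bounded amount, the sum of \<open>2 ^ Y\<close> over the graphs with
  \<open>Y \<ge> \<delta> n\<close> is at most half of the sum over all graphs, hence at most \<open>2 ^ (\<delta> n)\<close> times the number of
  graphs; so a proportion of at most \<open>2 ^ (- \<delta> n)\<close> of them has \<open>Y \<ge> 2 \<delta> n\<close>.\<close>

section \<open>Short cycles and forests in regular graphs\<close>

text \<open>Balls in terms of walks, without \<open>enat\<close>. The edge set is a parameter, so
  that distances after deleting an edge are of the same form.\<close>

definition reach :: "nat set set \<Rightarrow> nat \<Rightarrow> nat \<Rightarrow> nat set" where
  "reach E k u = {v. \<exists>j\<le>k. (u, v) \<in> adjacency E ^^ j}"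

text \<open>In a simple graph these are the edges on a cycle of length at most \<open>K + 1\<close>;
  deleting the edge and asking for a short walk between its ends avoids defining cycles.\<close>

definition short_cycle_edges :: "nat \<Rightarrow> nat set set \<Rightarrow> nat set set" where
  "short_cycle_edges K E = {e \<in> E. \<exists>u v. e = {u, v} \<and> v \<in> reach (E - {e}) K u}"

lemma adjacency_iff [simp]: "(u, v) \<in> adjacency E \<longleftrightarrow> {u, v} \<in> E"
  by (simp add: adjacency_def)

lemma adjacency_mono: "E \<subseteq> E' \<Longrightarrow> adjacency E \<subseteq> adjacency E'"
  by (auto simp: adjacency_def)

lemma adjacency_relpow_sym: "(u, v) \<in> adjacency E ^^ k \<Longrightarrow> (v, u) \<in> adjacency E ^^ k"
proof (induction k arbitrary: v)
  case (Suc k)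
  then obtain w where "(u, w) \<in> adjacency E ^^ k" "(w, v) \<in> adjacency E"
    by auto
  then show ?case
    using Suc.IH by (intro relpow_Suc_I2[of v w]) (auto simp: insert_commute)
qed simp

lemma reach_sym: "v \<in> reach E k u \<Longrightarrow> u \<in> reach E k v"
  unfolding reach_def using adjacency_relpow_sym by blast

lemma reach_trans: "v \<in> reach E j u \<Longrightarrow> w \<in> reach E k v \<Longrightarrow> w \<in> reach E (j + k) u"
  unfolding reach_def mem_Collect_eq by (meson add_mono relpow_trans)

lemma relpow_mono_rel:
  fixes R S :: "'a rel"
  shows "R \<subseteq> S \<Longrightarrow> R ^^ k \<subseteq> S ^^ k"
  by (induction k) auto

lemma reach_mono: "E \<subseteq> E' \<Longrightarrow> k \<le> k' \<Longrightarrow> reach E k u \<subseteq> reach E' k' u"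
  unfolding reach_def using relpow_mono_rel[OF adjacency_mono, of E E'] order_trans[of _ k k']
  by blast

lemma reach_refl [simp]: "u \<in> reach E k u"
  unfolding reach_def by (auto intro: exI[of _ 0])

lemma reach_edge: "{u, v} \<in> E \<Longrightarrow> v \<in> reach E 1 u"
  unfolding reach_def by (auto intro!: exI[of _ "Suc 0"])

lemma short_cycle_edges_iff:
  "{u, v} \<in> short_cycle_edges K E \<longleftrightarrow> {u, v} \<in> E \<and> v \<in> reach (E - {{u, v}}) K u"
  unfolding short_cycle_edges_def by (auto simp: doubleton_eq_iff dest: reach_sym)

section \<open>Acyclic edge sets\<close>

text \<open>Every edge is a bridge, so each edge added in the induction joins two different
  components. The labels \<open>f\<close> stand for components: equal labels imply connectedness, so
  the ends of the new edge have different labels, and merging these lowers the number of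
  labels.\<close>

lemma forest_representatives:
  assumes "finite E" "finite V" "\<forall>e\<in>E. e \<subseteq> V \<and> card e = 2"
    and "\<forall>u v. {u, v} \<in> E \<longrightarrow> (u, v) \<notin> (adjacency (E - {{u, v}}))\<^sup>*"
  shows "\<exists>f. f ` V \<subseteq> V \<and> (\<forall>x\<in>V. \<forall>y\<in>V. f x = f y \<longrightarrow> (x, y) \<in> (adjacency E)\<^sup>*) \<and>
    card (f ` V) + card E \<le> card V"
  using assms(1,3,4)
proof (induction E)
  case empty
  then show ?case by (intro exI[of _ id]) auto
next
  case (insert e E)
  \<comment> \<open>Deleting \<open>e\<close> creates no walks, so the bridge hypothesis passes to
    the smaller edge set.\<close>
  have sub: "(adjacency (E - {{u, v}}))\<^sup>* \<subseteq> (adjacency (insert e E - {{u, v}}))\<^sup>*" for u v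
    by (intro rtrancl_mono adjacency_mono) auto
  have "\<exists>f. f ` V \<subseteq> V \<and> (\<forall>x\<in>V. \<forall>y\<in>V. f x = f y \<longrightarrow> (x, y) \<in> (adjacency E)\<^sup>*) \<and>
    card (f ` V) + card E \<le> card V"
    using insert.prems sub by (intro insert.IH) blast+
  then obtain f where f: "f ` V \<subseteq> V" "\<And>x y. x \<in> V \<Longrightarrow> y \<in> V \<Longrightarrow> f x = f y \<Longrightarrow> (x, y) \<in> (adjacency E)\<^sup>*"
    "card (f ` V) + card E \<le> card V"
    by blast
  obtain u v where e: "e = {u, v}" "u \<noteq> v"
    using insert.prems(1) by (metis card_2_iff insertI1)
  have uv: "u \<in> V" "v \<in> V" using insert.prems(1) e by auto
  have "insert e E - {{u, v}} = E" using insert.hyps e by auto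
  then have "(u, v) \<notin> (adjacency E)\<^sup>*" using insert.prems(2) e by force
  then have ne: "f u \<noteq> f v" using f(2) uv by blast
  \<comment> \<open>Moves the class of \<open>u\<close> into that of \<open>v\<close>; the label
    \<open>f u\<close> disappears from the image.\<close>
  define g where "g x = (if f x = f u then f v else f x)" for x
  have E: "(adjacency E)\<^sup>* \<subseteq> (adjacency (insert e E))\<^sup>*"
    by (intro rtrancl_mono adjacency_mono) auto
  have uv': "(u, v) \<in> (adjacency (insert e E))\<^sup>*" "(v, u) \<in> (adjacency (insert e E))\<^sup>*"
    using e by (auto simp: insert_commute)
  have "(x, y) \<in> (adjacency (insert e E))\<^sup>*" if xy: "x \<in> V" "y \<in> V" "g x = g y" for x y
  proof (cases "f x = f y")
    case True
    then show ?thesis using f(2) xy E by blast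
  next
    case False
    then consider "f x = f u" "f y = f v" | "f x = f v" "f y = f u"
      using xy(3) ne unfolding g_def by (auto split: if_splits)
    then show ?thesis
    proof cases
      case 1
      then have "(x, u) \<in> (adjacency (insert e E))\<^sup>*" "(v, y) \<in> (adjacency (insert e E))\<^sup>*"
        using f(2) xy uv E by (metis subsetD)+
      then show ?thesis using uv' by (meson rtrancl_trans)
    next
      case 2
      then have "(x, v) \<in> (adjacency (insert e E))\<^sup>*" "(u, y) \<in> (adjacency (insert e E))\<^sup>*"
        using f(2) xy uv E by (metis subsetD)+
      then show ?thesis using uv' by (meson rtrancl_trans)
    qed
  qed
  moreover have "g ` V \<subseteq> V" using f(1) uv unfolding g_def by auto
  moreover have "card (g ` V) < card (f ` V)"
  proof (rule psubset_card_mono)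
    show "g ` V \<subset> f ` V"
      using uv ne unfolding g_def by (auto simp: image_iff)
  qed (use \<open>finite V\<close> in simp)
  ultimately show ?case using f(3) insert.hyps by (intro exI[of _ g]) auto
qed

lemma forest_card_le:
  assumes "finite E" "finite V" "\<forall>e\<in>E. e \<subseteq> V \<and> card e = 2"
    and "\<forall>u v. {u, v} \<in> E \<longrightarrow> (u, v) \<notin> (adjacency (E - {{u, v}}))\<^sup>*"
  shows "card E \<le> card V"
  using forest_representatives[OF assms] by auto

section \<open>Degrees and balls in regular graphs\<close>

lemma regular_graphsD:
  assumes "E \<in> regular_graphs n d"
  shows "finite E" "\<And>e. e \<in> E \<Longrightarrow> e \<subseteq> {..<n}" "\<And>e. e \<in> E \<Longrightarrow> card e = 2"
    "\<And>v. v < n \<Longrightarrow> vertex_degree E v = d"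
proof -
  have "E \<subseteq> Pow {..<n}" using assms by (auto simp: regular_graphs_def simple_graph_def)
  then show "finite E" by (rule finite_subset) simp
qed (use assms in \<open>auto simp: regular_graphs_def simple_graph_def\<close>)

lemma regular_graphs_edgeD:
  assumes "E \<in> regular_graphs n d" "{u, v} \<in> E"
  shows "u < n" "v < n" "u \<noteq> v"
  using regular_graphsD(2,3)[OF assms] by auto

lemma finite_regular_graphs: "finite (regular_graphs n d)"
  by (rule finite_subset[of _ "Pow (Pow {..<n})"])
     (auto simp: regular_graphs_def simple_graph_def)

lemma neighbours_eq_image:
  assumes "E \<in> regular_graphs n d"
  shows "(\<lambda>w. {v, w}) ` (adjacency E `` {v}) = {e \<in> E. v \<in> e}"
proof
  show "{e \<in> E. v \<in> e} \<subseteq> (\<lambda>w. {v, w}) ` (adjacency E `` {v})"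
  proof
    fix e assume "e \<in> {e \<in> E. v \<in> e}"
    then have e: "e \<in> E" "v \<in> e" "card e = 2"
      using regular_graphsD(3)[OF assms] by auto
    then obtain x y where "e = {x, y}" by (auto simp: card_2_iff)
    then obtain w where "e = {v, w}" using e(2) by blast
    then show "e \<in> (\<lambda>w. {v, w}) ` (adjacency E `` {v})" using e(1) by auto
  qed
qed auto

lemma card_neighbours:
  assumes "E \<in> regular_graphs n d" "v < n"
  shows "card (adjacency E `` {v}) = d"
proof -
  have "card (adjacency E `` {v}) = card ((\<lambda>w. {v, w}) ` (adjacency E `` {v}))"
    by (intro card_image[symmetric]) (auto simp: inj_on_def doubleton_eq_iff)
  then show ?thesis
    using regular_graphsD(4)[OF assms] neighbours_eq_image[OF assms(1)]
    by (simp add: vertex_degree_def)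
qed

lemma neighbours_subset: "E \<in> regular_graphs n d \<Longrightarrow> adjacency E `` {v} \<subseteq> {..<n}"
  using regular_graphsD(2) by fastforce

lemma finite_neighbours: "E \<in> regular_graphs n d \<Longrightarrow> finite (adjacency E `` {v})"
  by (meson finite_lessThan finite_subset neighbours_subset)

lemma card_neighbours_le:
  assumes "E \<in> regular_graphs n d"
  shows "card (adjacency E `` {v}) \<le> d"
proof (cases "v < n")
  case False
  then have "adjacency E `` {v} = {}"
    using regular_graphs_edgeD[OF assms] by auto
  then show ?thesis by (metis card.empty le0)
qed (simp add: card_neighbours[OF assms])

lemma card_relpow_Image:
  assumes "E \<in> regular_graphs n d"
  shows "finite ((adjacency E ^^ k) `` {u}) \<and> card ((adjacency E ^^ k) `` {u}) \<le> d ^ k"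
proof (induction k)
  case (Suc k)
  let ?S = "(adjacency E ^^ k) `` {u}"
  have eq: "(adjacency E ^^ Suc k) `` {u} = (\<Union>x\<in>?S. adjacency E `` {x})" by auto
  have "card (\<Union>x\<in>?S. adjacency E `` {x}) \<le> (\<Sum>x\<in>?S. card (adjacency E `` {x}))"
    using Suc by (intro card_UN_le) auto
  also have "\<dots> \<le> card ?S * d"
    using card_neighbours_le[OF assms] by (intro sum_bounded_above[of ?S _ d, simplified]) auto
  also have "\<dots> \<le> d ^ k * d" using Suc by (intro mult_right_mono) auto
  finally show ?case unfolding eq using Suc finite_neighbours[OF assms] by (simp add: mult.commute)
qed simp

text \<open>A crude bound on the size of a ball; what matters is that it does not depend on
  \<open>n\<close>.\<close>

definition ball_bound :: "nat \<Rightarrow> nat \<Rightarrow> nat" where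
  "ball_bound d k = (\<Sum>j\<le>k. d ^ j)"

lemma card_reach:
  assumes "E \<in> regular_graphs n d"
  shows "finite (reach E k u)" "card (reach E k u) \<le> ball_bound d k"
proof -
  have eq: "reach E k u = (\<Union>j\<in>{..k}. (adjacency E ^^ j) `` {u})"
    unfolding reach_def by auto
  show "finite (reach E k u)" unfolding eq using card_relpow_Image[OF assms] by auto
  show "card (reach E k u) \<le> ball_bound d k" unfolding eq ball_bound_def
    by (rule order_trans[OF card_UN_le]) (use card_relpow_Image[OF assms] in \<open>auto intro: sum_mono\<close>)
qed

text \<open>A component of \<open>F\<close> lies in a ball of bounded size, so a cycle in
  \<open>F\<close> can be shortened to a length at most \<open>K + 1\<close> with \<open>K\<close>
  the square of that size. Hence the edges of \<open>F\<close> outside short cycles form a forest on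
  \<open>n\<close> vertices.\<close>

lemma card_le_of_bounded_components:
  assumes E: "E \<in> regular_graphs n d" and "F \<subseteq> E"
    and bounded: "\<And>u v. (u, v) \<in> (adjacency F)\<^sup>* \<Longrightarrow> v \<in> reach E r u"
  shows "card F \<le> n + card (short_cycle_edges ((ball_bound d r)\<^sup>2) E)"
proof -
  let ?K = "(ball_bound d r)\<^sup>2"
  let ?F = "F - short_cycle_edges ?K E"
  have fin: "finite F" using regular_graphsD(1)[OF E] \<open>F \<subseteq> E\<close> finite_subset by blast
  have "card ?F \<le> card {..<n}"
  proof (rule forest_card_le)
    show "\<forall>u v. {u, v} \<in> ?F \<longrightarrow> (u, v) \<notin> (adjacency (?F - {{u, v}}))\<^sup>*"
    proof (intro allI impI notI)
      fix u v assume uv: "{u, v} \<in> ?F" and *: "(u, v) \<in> (adjacency (?F - {{u, v}}))\<^sup>*"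
      let ?C = "reach E r u"
      \<comment> \<open>Restricted to the ball, the relation has at most \<open>?K\<close> pairs,
        and reachability in a finite relation takes no more steps than it has pairs. This is the
        origin of the square.\<close>
      let ?R = "adjacency (?F - {{u, v}}) \<inter> ?C \<times> ?C"
      have sub: "(adjacency (?F - {{u, v}}))\<^sup>* \<subseteq> (adjacency F)\<^sup>*"
        by (intro rtrancl_mono adjacency_mono) auto
      have "(u, z) \<in> ?R\<^sup>*" if "(u, z) \<in> (adjacency (?F - {{u, v}}))\<^sup>*" for z
        using that
      proof (induction rule: rtrancl_induct)
        case (step y z)
        have "y \<in> ?C" "z \<in> ?C"
          using step.hyps sub bounded by (meson rtrancl.rtrancl_into_rtrancl subsetD)+
        then have "(y, z) \<in> ?R" using step.hyps by blast
        then show ?case using step.IH by (meson rtrancl.rtrancl_into_rtrancl)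
      qed simp
      with * have "(u, v) \<in> ?R\<^sup>*" by blast
      moreover have finC: "finite (?C \<times> ?C)" using card_reach(1)[OF E] by simp
      then have finR: "finite ?R" by (rule finite_subset[rotated]) blast
      ultimately obtain j where j: "j \<le> card ?R" "(u, v) \<in> ?R ^^ j"
        using rtrancl_finite_eq_relpow[of ?R] by auto
      have "card ?R \<le> card (?C \<times> ?C)" by (intro card_mono finC) blast
      also have "\<dots> \<le> ?K"
        using card_reach(2)[OF E, of r u] by (simp add: card_cartesian_product power2_eq_square mult_mono)
      finally have "j \<le> ?K" using j by simp
      moreover have "(u, v) \<in> adjacency (E - {{u, v}}) ^^ j"
        using j(2) \<open>F \<subseteq> E\<close> by (elim rev_subsetD, intro relpow_mono_rel) (auto simp: adjacency_def)
      ultimately have "v \<in> reach (E - {{u, v}}) ?K u" unfolding reach_def by auto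
      then show False using uv \<open>F \<subseteq> E\<close> short_cycle_edges_iff by blast
    qed
    show "\<forall>e\<in>?F. e \<subseteq> {..<n} \<and> card e = 2"
      using regular_graphsD[OF E] \<open>F \<subseteq> E\<close> by blast
  qed (use fin in auto)
  moreover have "card F \<le> card ?F + card (short_cycle_edges ?K E)"
  proof -
    have "finite (short_cycle_edges ?K E)"
      using regular_graphsD(1)[OF E] by (simp add: short_cycle_edges_def)
    then have "card F \<le> card (?F \<union> short_cycle_edges ?K E)"
      using fin by (intro card_mono) auto
    then show ?thesis using card_Un_le le_trans by blast
  qed
  ultimately show ?thesis by simp
qed

section \<open>Switchings\<close>

definition switch :: "nat set set \<Rightarrow> nat \<times> nat \<times> nat \<times> nat \<Rightarrow> nat set set" where
  "switch E = (\<lambda>(a, b, c, h). E - {{a, b}, {c, h}} \<union> {{a, c}, {b, h}})"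

text \<open>The margin \<open>K + 3\<close> leaves both \<open>c\<close> and its neighbour
  \<open>h\<close> outside the ball of radius \<open>K + 2\<close> around \<open>a\<close>. Radius
  \<open>2\<close> keeps the new edges from being present already, radius \<open>K\<close> keeps the
  short walk from \<open>a\<close> to \<open>b\<close> away from \<open>{c, h}\<close>.\<close>

definition switchings :: "nat \<Rightarrow> nat set set \<Rightarrow> (nat \<times> nat \<times> nat \<times> nat) set" where
  "switchings K E =
    {(a, b, c, h). {a, b} \<in> short_cycle_edges K E \<and> {c, h} \<in> E \<and> c \<notin> reach E (K + 3) a}"

text \<open>What can be said in the new graph \<open>E\<close> about a switching that has led to it.
  Only an upper bound on the number of such tuples matters.\<close>

definition reverse_switchings :: "nat \<Rightarrow> nat set set \<Rightarrow> (nat \<times> nat \<times> nat \<times> nat) set" where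
  "reverse_switchings K E =
    {(a, b, c, h). {a, c} \<in> E \<and> {b, h} \<in> E \<and> b \<in> reach E K a}"

lemma reach_mono_steps: "v \<in> reach E k u \<Longrightarrow> k \<le> k' \<Longrightarrow> v \<in> reach E k' u"
  using reach_mono[of E E] by blast

text \<open>A walk that uses the edge \<open>f\<close> visits an end of \<open>f\<close> on its
  way.\<close>

lemma reach_avoiding:
  assumes "v \<in> reach E k u"
  shows "v \<in> reach (E - {f}) k u \<or> (\<exists>x\<in>f. x \<in> reach E k u)"
proof -
  have "(u, v) \<in> adjacency (E - {f}) ^^ j \<or> (\<exists>x\<in>f. \<exists>i\<le>j. (u, x) \<in> adjacency E ^^ i)"
    if "(u, v) \<in> adjacency E ^^ j" for j
    using that
  proof (induction j arbitrary: v)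
    case (Suc j)
    then obtain w where w: "(u, w) \<in> adjacency E ^^ j" "{w, v} \<in> E" by auto
    show ?case
    proof (cases "{w, v} = f")
      case True
      then show ?thesis using w(1) le_SucI[OF order_refl] by blast
    next
      case False
      then have "(w, v) \<in> adjacency (E - {f})" using w by auto
      then show ?thesis using Suc.IH[OF w(1)] le_SucI by (meson relpow_Suc_I)
    qed
  qed simp
  then show ?thesis
    using assms unfolding reach_def mem_Collect_eq by (meson order_trans)
qed

text \<open>Since \<open>b\<close> is adjacent to \<open>a\<close> while \<open>c\<close> and
  \<open>h\<close> are remote from \<open>a\<close>, the four vertices are distinct and the new
  edges are absent from \<open>E\<close>.\<close>

lemma switchingsD:
  assumes E: "E \<in> regular_graphs n d" and t: "(a, b, c, h) \<in> switchings K E"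
  shows "{a, b} \<in> E" "{c, h} \<in> E" "{a, c} \<notin> E" "{b, h} \<notin> E"
    "c \<notin> reach E (K + 2) a" "h \<notin> reach E (K + 2) a"
    "distinct [a, b, c, h]"
proof -
  show ab: "{a, b} \<in> E" and ch: "{c, h} \<in> E"
    using t by (auto simp: switchings_def short_cycle_edges_def)
  have c: "c \<notin> reach E (K + 3) a" using t by (auto simp: switchings_def)
  show c': "c \<notin> reach E (K + 2) a" using c reach_mono_steps[of c E "K + 2" a "K + 3"] by auto
  show h: "h \<notin> reach E (K + 2) a"
  proof
    assume "h \<in> reach E (K + 2) a"
    moreover have "c \<in> reach E 1 h" using ch reach_edge[of h c] by (simp add: insert_commute)
    ultimately have "c \<in> reach E (K + 2 + 1) a" by (rule reach_trans)
    then show False using c by (simp add: numeral_3_eq_3)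
  qed
  have ne: "a \<noteq> b" "c \<noteq> h" using ab ch regular_graphs_edgeD[OF E] by auto
  have b: "b \<in> reach E 1 a" using ab reach_edge by blast
  have b2: "b \<in> reach E (K + 2) a" using b by (rule reach_mono_steps) simp
  show "{a, c} \<notin> E"
    using reach_edge[of a c E] c' reach_mono_steps[of c E 1 a "K + 2"] by auto
  show "{b, h} \<notin> E"
  proof
    assume "{b, h} \<in> E"
    then have "h \<in> reach E (1 + 1) a" using b reach_edge reach_trans by blast
    then show False using h reach_mono_steps[of h E "1 + 1" a "K + 2"] by auto
  qed
  show "distinct [a, b, c, h]"
    using ne b2 c' h by auto
qed

text \<open>The old edges are present and the new ones absent, so the tuple and the new graph
  determine the old graph. This gives injectivity in the double count.\<close>

lemma switch_inverse:
  assumes E: "E \<in> regular_graphs n d" and t: "(a, b, c, h) \<in> switchings K E"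
  shows "E = switch E (a, b, c, h) - {{a, c}, {b, h}} \<union> {{a, b}, {c, h}}"
  using switchingsD[OF E t] unfolding switch_def by (auto simp: doubleton_eq_iff)

lemma vertex_degree_eq_sum:
  "finite E \<Longrightarrow> int (vertex_degree E v) = (\<Sum>e\<in>E. of_bool (v \<in> e))"
  unfolding vertex_degree_def by (simp add: Int_def)

text \<open>Each of the four vertices lies on exactly one removed and one added edge, so all degrees
  are kept.\<close>

lemma switch_regular:
  assumes E: "E \<in> regular_graphs n d" and t: "t \<in> switchings K E"
  shows "switch E t \<in> regular_graphs n d"
proof -
  obtain a b c h where t_eq: "t = (a, b, c, h)" by (cases t)
  note * = switchingsD[OF E t[unfolded t_eq]]
  let ?E = "switch E t"
  have fin: "finite E" using regular_graphsD(1)[OF E] .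
  have simple: "e \<subseteq> {..<n} \<and> card e = 2" if "e \<in> ?E" for e
  proof -
    have "a < n" "b < n" "c < n" "h < n"
      using *(1,2) regular_graphs_edgeD[OF E] by auto
    then show ?thesis
      using that *(7) regular_graphsD(2,3)[OF E] unfolding t_eq switch_def by auto
  qed
  have "vertex_degree ?E v = vertex_degree E v" for v
  proof -
    have E': "?E = insert {a, c} (insert {b, h} (E - {{a, b}, {c, h}}))"
      unfolding t_eq switch_def by auto
    have E0: "E = insert {a, b} (insert {c, h} (E - {{a, b}, {c, h}}))"
      using *(1,2) by auto
    let ?\<chi> = "\<lambda>e. of_bool (v \<in> e) :: int"
    have "{a, c} \<noteq> {b, h}" "{a, b} \<noteq> {c, h}"
      using *(7) by (auto simp: doubleton_eq_iff)
    then have "sum ?\<chi> ?E = ?\<chi> {a, c} + (?\<chi> {b, h} + sum ?\<chi> (E - {{a, b}, {c, h}}))"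
      "sum ?\<chi> E = ?\<chi> {a, b} + (?\<chi> {c, h} + sum ?\<chi> (E - {{a, b}, {c, h}}))"
      using fin * by (subst E' E0, simp)+
    moreover have "?\<chi> {a, c} + ?\<chi> {b, h} = ?\<chi> {a, b} + ?\<chi> {c, h}"
      using *(7) by auto
    ultimately have "sum ?\<chi> ?E = sum ?\<chi> E" by linarith
    moreover have "finite ?E" using fin unfolding E' by simp
    ultimately have "int (vertex_degree ?E v) = int (vertex_degree E v)"
      using fin by (simp only: vertex_degree_eq_sum)
    then show ?thesis by simp
  qed
  then show ?thesis
    using simple regular_graphsD(4)[OF E] by (simp add: regular_graphs_def simple_graph_def)
qed

text \<open>The short walk from \<open>a\<close> to \<open>b\<close> avoids \<open>{a, b}\<close> by
  the choice of that edge, and \<open>{c, h}\<close> because its ends are too far from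
  \<open>a\<close>; so it survives the switching.\<close>

lemma switching_reversible:
  assumes E: "E \<in> regular_graphs n d" and t: "t \<in> switchings K E"
  shows "t \<in> reverse_switchings K (switch E t)"
proof -
  obtain a b c h where t_eq: "t = (a, b, c, h)" by (cases t)
  note * = switchingsD[OF E t[unfolded t_eq]]
  have "b \<in> reach (E - {{a, b}}) K a"
    using t short_cycle_edges_iff unfolding t_eq switchings_def by blast
  moreover have "x \<notin> reach (E - {{a, b}}) K a" if "x \<in> {c, h}" for x
    using that *(5,6) reach_mono[of "E - {{a, b}}" E K "K + 2" a] by auto
  ultimately have "b \<in> reach (E - {{a, b}} - {{c, h}}) K a"
    using reach_avoiding by blast
  then have "b \<in> reach (switch E t) K a"
    using reach_mono[of "E - {{a, b}} - {{c, h}}" "switch E t" K K a]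
    unfolding t_eq switch_def by auto
  then show ?thesis unfolding t_eq reverse_switchings_def switch_def by auto
qed

lemma card_edges_at:
  assumes E: "E \<in> regular_graphs n d"
  shows "card {e \<in> E. v \<in> e} \<le> d"
proof -
  have "card ((\<lambda>w. {v, w}) ` (adjacency E `` {v})) \<le> card (adjacency E `` {v})"
    by (intro card_image_le finite_neighbours[OF E])
  then show ?thesis
    using neighbours_eq_image[OF E] card_neighbours_le[OF E] order_trans by metis
qed

section \<open>Counting switchings in both directions\<close>

text \<open>Four balls of radius \<open>K\<close>, at most \<open>d\<close> edges at each of their
  vertices, and the two removed edges.\<close>

definition switching_change :: "nat \<Rightarrow> nat \<Rightarrow> nat" where
  "switching_change d K = 4 * ball_bound d K * d + 2"

lemma finite_short_cycle_edges: "E \<in> regular_graphs n d \<Longrightarrow> finite (short_cycle_edges K E)"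
  using regular_graphsD(1) by (simp add: short_cycle_edges_def)

text \<open>An edge leaves the short cycles only if it is removed, or if its short walk meets
  \<open>a\<close>, \<open>b\<close>, \<open>c\<close> or \<open>h\<close>; in the latter case it
  has an end within \<open>K\<close> of one of these vertices.\<close>

lemma short_cycle_edges_switch:
  assumes E: "E \<in> regular_graphs n d" and t: "t \<in> switchings K E"
  shows "card (short_cycle_edges K E)
    \<le> card (short_cycle_edges K (switch E t)) + switching_change d K"
proof -
  obtain a b c h where t_eq: "t = (a, b, c, h)" by (cases t)
  let ?E = "switch E t"
  let ?W = "reach E K a \<union> reach E K b \<union> reach E K c \<union> reach E K h"
  let ?X = "\<Union>w\<in>?W. {e \<in> E. w \<in> e}"
  have sub: "short_cycle_edges K E \<subseteq> short_cycle_edges K ?E \<union> ({{a, b}, {c, h}} \<union> ?X)"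
  proof
    fix e assume e: "e \<in> short_cycle_edges K E"
    show "e \<in> short_cycle_edges K ?E \<union> ({{a, b}, {c, h}} \<union> ?X)"
    proof (cases "e \<in> {{a, b}, {c, h}}")
      case False
      obtain x y where xy: "e = {x, y}" "e \<in> E" "y \<in> reach (E - {e}) K x"
        using e unfolding short_cycle_edges_def by blast
      \<comment> \<open>Either the walk avoids both removed edges, or it visits an end of one of
        them.\<close>
      consider "y \<in> reach (E - {e} - {{a, b}} - {{c, h}}) K x"
        | z where "z \<in> {a, b, c, h}" "z \<in> reach E K x"
      proof -
        have *: "reach (E - {e}) K x \<subseteq> reach E K x" "reach (E - {e} - {{a, b}}) K x \<subseteq> reach E K x"
          by (intro reach_mono; blast)+
        show ?thesis
          using reach_avoiding[OF xy(3), of "{a, b}"] reach_avoiding[of y "E - {e} - {{a, b}}" K x "{c, h}"]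
            * that by blast
      qed
      then show ?thesis
      proof cases
        case 1
        have "E - {e} - {{a, b}} - {{c, h}} \<subseteq> ?E - {e}"
          unfolding t_eq switch_def by auto
        then have "reach (E - {e} - {{a, b}} - {{c, h}}) K x \<subseteq> reach (?E - {e}) K x"
          by (rule reach_mono) simp
        then have "y \<in> reach (?E - {e}) K x" using 1 by blast
        moreover have "e \<in> ?E" using xy(2) False unfolding t_eq switch_def by auto
        ultimately show ?thesis using xy(1) unfolding short_cycle_edges_def by blast
      next
        case 2
        have "x \<in> reach E K z" using 2(2) by (rule reach_sym)
        then have "x \<in> ?W" using 2(1) by auto
        moreover have "e \<in> {e \<in> E. x \<in> e}" using xy(1,2) by simp
        ultimately have "e \<in> ?X" by (rule UN_I)
        then show ?thesis by (intro UnI2)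
      qed
    qed blast
  qed
  have finW: "finite ?W" using card_reach(1)[OF E] by simp
  have finX: "finite ?X" using finW regular_graphsD(1)[OF E] by auto
  have cardW: "card ?W \<le> 4 * ball_bound d K"
    using card_Un_le[of "reach E K a \<union> reach E K b \<union> reach E K c" "reach E K h"]
      card_Un_le[of "reach E K a \<union> reach E K b" "reach E K c"]
      card_Un_le[of "reach E K a" "reach E K b"]
      card_reach(2)[OF E, of K a] card_reach(2)[OF E, of K b]
      card_reach(2)[OF E, of K c] card_reach(2)[OF E, of K h] by linarith
  have "card ?X \<le> (\<Sum>w\<in>?W. card {e \<in> E. w \<in> e})"
    by (intro card_UN_le finW)
  also have "\<dots> \<le> of_nat (card ?W) * d"
    by (intro sum_bounded_above card_edges_at[OF E])
  also have "\<dots> \<le> 4 * ball_bound d K * d"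
    using cardW by simp
  finally have cardX: "card ?X \<le> 4 * ball_bound d K * d" .
  have "card ({{a, b}, {c, h}} \<union> ?X) \<le> card {{a, b}, {c, h}} + card ?X"
    by (rule card_Un_le)
  also have "\<dots> \<le> switching_change d K"
    using cardX card_insert_le_m1[of 2 "{{c, h}}" "{a, b}"] unfolding switching_change_def by simp
  finally have "card ({{a, b}, {c, h}} \<union> ?X) \<le> switching_change d K" .
  moreover have "card (short_cycle_edges K E)
      \<le> card (short_cycle_edges K ?E \<union> ({{a, b}, {c, h}} \<union> ?X))"
    using finX finite_short_cycle_edges[OF switch_regular[OF E t]] sub by (intro card_mono) auto
  ultimately show ?thesis
    using card_Un_le[of "short_cycle_edges K ?E" "{{a, b}, {c, h}} \<union> ?X"] by linarith
qed

lemma card_Sigma_le: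
  assumes "finite A" "\<And>a. a \<in> A \<Longrightarrow> finite (B a) \<and> card (B a) \<le> m"
  shows "finite (Sigma A B) \<and> card (Sigma A B) \<le> card A * m"
proof -
  have "(\<Sum>a\<in>A. card (B a)) \<le> of_nat (card A) * m"
    using assms by (intro sum_bounded_above) auto
  then show ?thesis using assms by auto
qed

text \<open>Choose \<open>a\<close> freely, \<open>b\<close> near \<open>a\<close>, then
  \<open>c\<close> and \<open>h\<close> as neighbours of \<open>a\<close> and \<open>b\<close>. The
  bound is linear in \<open>n\<close>.\<close>

lemma card_reverse_switchings:
  assumes E: "E \<in> regular_graphs n d"
  shows "finite (reverse_switchings K E)"
    "card (reverse_switchings K E) \<le> n * (ball_bound d K * (d * d))"
proof -
  let ?S = "SIGMA a:{..<n}. SIGMA b:reach E K a. adjacency E `` {a} \<times> adjacency E `` {b}"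
  have eq: "reverse_switchings K E = ?S"
    using regular_graphs_edgeD[OF E] unfolding reverse_switchings_def by fastforce
  have "finite (SIGMA b:reach E K a. adjacency E `` {a} \<times> adjacency E `` {b}) \<and>
    card (SIGMA b:reach E K a. adjacency E `` {a} \<times> adjacency E `` {b}) \<le> ball_bound d K * (d * d)" for a
  proof -
    have "finite (SIGMA b:reach E K a. adjacency E `` {a} \<times> adjacency E `` {b}) \<and>
      card (SIGMA b:reach E K a. adjacency E `` {a} \<times> adjacency E `` {b}) \<le> card (reach E K a) * (d * d)"
      using finite_neighbours[OF E] card_neighbours_le[OF E]
      by (intro card_Sigma_le card_reach(1)[OF E]) (simp add: card_cartesian_product mult_mono)
    then show ?thesis using card_reach(2)[OF E, of K a] mult_le_mono1 order_trans by blast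
  qed
  then have "finite ?S \<and> card ?S \<le> card {..<n} * (ball_bound d K * (d * d))"
    by (intro card_Sigma_le) auto
  then show "finite (reverse_switchings K E)"
    "card (reverse_switchings K E) \<le> n * (ball_bound d K * (d * d))"
    unfolding eq by auto
qed

lemma finite_switchings:
  assumes "E \<in> regular_graphs n d"
  shows "finite (switchings K E)"
  by (rule finite_subset[of _ "{..<n} \<times> {..<n} \<times> {..<n} \<times> {..<n}"])
     (use regular_graphs_edgeD[OF assms] in \<open>auto simp: switchings_def short_cycle_edges_def\<close>)

text \<open>Each edge on a short cycle can be combined with every \<open>c\<close> outside a bounded
  ball and with each of the \<open>d\<close> neighbours of \<open>c\<close>. With order
  \<open>n\<close> such edges this is quadratic in \<open>n\<close>.\<close>

lemma card_switchings:
  assumes E: "E \<in> regular_graphs n d"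
  shows "card (short_cycle_edges K E) * ((n - ball_bound d (K + 3)) * d) \<le> card (switchings K E)"
proof -
  let ?Q = "\<lambda>p :: nat \<times> nat. SIGMA c:{..<n} - reach E (K + 3) (fst p). adjacency E `` {c}"
  \<comment> \<open>Oriented edges; the bound does not exploit that each edge has two
    orientations.\<close>
  define P where "P = {(a, b). {a, b} \<in> short_cycle_edges K E}"
  have finP: "finite P"
    by (rule finite_subset[of _ "{..<n} \<times> {..<n}"])
       (use regular_graphs_edgeD[OF E] in \<open>auto simp: P_def short_cycle_edges_def\<close>)
  have "short_cycle_edges K E = (\<lambda>(a, b). {a, b}) ` P"
    unfolding P_def by (auto simp: image_iff short_cycle_edges_def)
  then have cardP: "card (short_cycle_edges K E) \<le> card P"
    using card_image_le[OF finP] by metis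
  have cardQ: "(n - ball_bound d (K + 3)) * d \<le> card (?Q p)" and finQ: "finite (?Q p)" for p
  proof -
    have "card (?Q p) = (\<Sum>c\<in>{..<n} - reach E (K + 3) (fst p). d)"
      using finite_neighbours[OF E] card_neighbours[OF E]
      by (subst card_SigmaI) auto
    also have "\<dots> = card ({..<n} - reach E (K + 3) (fst p)) * d" by simp
    finally have *: "card (?Q p) = card ({..<n} - reach E (K + 3) (fst p)) * d" .
    have "n - ball_bound d (K + 3) \<le> card ({..<n} - reach E (K + 3) (fst p))"
      using diff_card_le_card_Diff[OF card_reach(1)[OF E], of "{..<n}" "K + 3" "fst p"]
        card_reach(2)[OF E, of "K + 3" "fst p"] by simp
    then show "(n - ball_bound d (K + 3)) * d \<le> card (?Q p)" unfolding * by simp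
    show "finite (?Q p)" using finite_neighbours[OF E] by auto
  qed
  have "card (short_cycle_edges K E) * ((n - ball_bound d (K + 3)) * d) \<le>
      card P * ((n - ball_bound d (K + 3)) * d)"
    using cardP by simp
  also have "\<dots> \<le> (\<Sum>p\<in>P. card (?Q p))"
    using sum_bounded_below[OF cardQ] by simp
  also have "\<dots> = card (Sigma P ?Q)"
    using finP finQ by (intro card_SigmaI[symmetric]) auto
  also have "\<dots> = card ((\<lambda>((a, b), (c, h)). (a, b, c, h)) ` Sigma P ?Q)"
    by (intro card_image[symmetric]) (auto simp: inj_on_def)
  also have "\<dots> \<le> card (switchings K E)"
    by (intro card_mono finite_switchings[OF E]) (auto simp: switchings_def P_def)
  finally show ?thesis .
qed

text \<open>Pairs of a graph and a switching are counted with weight \<open>2 ^ Y\<close>, once at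
  the old graph and once at the new one.\<close>

lemma switching_double_count:
  fixes s K :: nat
  defines "Y \<equiv> \<lambda>E. card (short_cycle_edges K E)"
  shows "(\<Sum>E\<in>{E \<in> regular_graphs n d. s \<le> Y E}. 2 ^ Y E) * real (s * ((n - ball_bound d (K + 3)) * d))
    \<le> real (n * (ball_bound d K * (d * d))) * 2 ^ switching_change d K *
      (\<Sum>E\<in>regular_graphs n d. 2 ^ Y E)"
proof -
  let ?S = "regular_graphs n d" and ?D = "switching_change d K"
  let ?A = "{E \<in> ?S. s \<le> Y E}"
  let ?m = "n * (ball_bound d K * (d * d))"
  let ?f = "\<lambda>(E, t). (switch E t, t)"
  \<comment> \<open>The tuple is kept as second component, so that the old graph can be
    recovered.\<close>
  have inj: "inj_on ?f (Sigma ?A (switchings K))"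
  proof (rule inj_onI)
    fix p q assume p: "p \<in> Sigma ?A (switchings K)" and q: "q \<in> Sigma ?A (switchings K)"
      and eq: "?f p = ?f q"
    obtain E a b c h where pe: "p = (E, (a, b, c, h))" by (cases p)
    obtain E' where qe: "q = (E', (a, b, c, h))" using eq pe by (cases q) auto
    have "E = E'"
      using switch_inverse[of E n d a b c h K] switch_inverse[of E' n d a b c h K] p q eq
      unfolding pe qe by simp
    then show "p = q" using pe qe by simp
  qed
  have img: "?f ` Sigma ?A (switchings K) \<subseteq> Sigma ?S (reverse_switchings K)"
    using switch_regular switching_reversible by auto
  have "(\<Sum>E\<in>?A. 2 ^ Y E) * real (s * ((n - ball_bound d (K + 3)) * d))
      = (\<Sum>E\<in>?A. 2 ^ Y E * real (s * ((n - ball_bound d (K + 3)) * d)))"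
    by (rule sum_distrib_right)
  also have "\<dots> \<le> (\<Sum>E\<in>?A. 2 ^ Y E * real (card (switchings K E)))"
  proof (intro sum_mono mult_left_mono)
    fix E assume E: "E \<in> ?A"
    have "s * ((n - ball_bound d (K + 3)) * d) \<le> Y E * ((n - ball_bound d (K + 3)) * d)"
      using E by (intro mult_right_mono) auto
    also have "\<dots> \<le> card (switchings K E)"
      using E card_switchings unfolding Y_def by blast
    finally show "real (s * ((n - ball_bound d (K + 3)) * d)) \<le> real (card (switchings K E))"
      by (rule of_nat_mono)
  qed simp
  also have "\<dots> = (\<Sum>E\<in>?A. \<Sum>t\<in>switchings K E. 2 ^ Y E)"
    by (simp add: mult.commute)
  also have "\<dots> = (\<Sum>(E, t)\<in>Sigma ?A (switchings K). 2 ^ Y E)"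
    using finite_regular_graphs finite_switchings by (intro sum.Sigma) auto
  \<comment> \<open>A switching lowers \<open>Y\<close> by at most \<open>?D\<close>, so the weight
    passes to the new graph at the cost of a factor \<open>2 ^ ?D\<close>.\<close>
  also have "\<dots> \<le> (\<Sum>(E, t)\<in>Sigma ?A (switchings K). 2 ^ (Y (switch E t) + ?D))"
    using short_cycle_edges_switch unfolding Y_def
    by (intro sum_mono) (auto intro!: power_increasing)
  also have "\<dots> = (\<Sum>(E, t)\<in>?f ` Sigma ?A (switchings K). 2 ^ (Y E + ?D))"
    by (subst sum.reindex[OF inj]) (simp add: case_prod_beta comp_def)
  \<comment> \<open>The new graph may have \<open>Y\<close> below \<open>s\<close>, so the sum now
    ranges over \<open>?S\<close> instead of \<open>?A\<close>.\<close>
  also have "\<dots> \<le> (\<Sum>(E, t)\<in>Sigma ?S (reverse_switchings K). 2 ^ (Y E + ?D))"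
    using finite_regular_graphs card_reverse_switchings(1)
    by (intro sum_mono2 img) (auto)
  also have "\<dots> = (\<Sum>E\<in>?S. \<Sum>t\<in>reverse_switchings K E. 2 ^ (Y E + ?D))"
    using finite_regular_graphs card_reverse_switchings(1) by (intro sum.Sigma[symmetric]) auto
  also have "\<dots> = (\<Sum>E\<in>?S. real (card (reverse_switchings K E)) * 2 ^ (Y E + ?D))"
    by simp
  also have "\<dots> \<le> (\<Sum>E\<in>?S. real ?m * 2 ^ (Y E + ?D))"
    using card_reverse_switchings(2) by (intro sum_mono mult_right_mono of_nat_mono) auto
  also have "\<dots> = real ?m * 2 ^ ?D * (\<Sum>E\<in>?S. 2 ^ Y E)"
    by (simp add: sum_distrib_left power_add mult_ac)
  finally show ?thesis .
qed

section \<open>Exponential tail for the number of edges on short cycles\<close>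

text \<open>By \<open>large\<close>, graphs with \<open>Y\<close> at least \<open>s\<close> carry at
  most half of the total weight \<open>2 ^ Y\<close>, hence no more than the remaining graphs, whose
  weights are below \<open>2 ^ s\<close>. Markov's inequality for \<open>2 ^ Y\<close> at
  \<open>2 * s\<close> then gains the factor \<open>2 ^ s\<close>.\<close>

lemma short_cycle_edges_tail:
  fixes s K :: nat
  defines "Y \<equiv> \<lambda>E. card (short_cycle_edges K E)"
  assumes large: "2 * (n * (ball_bound d K * d)) * 2 ^ switching_change d K
      \<le> s * (n - ball_bound d (K + 3))"
    and pos: "0 < s * (n - ball_bound d (K + 3)) * d"
  shows "2 ^ s * real (card {E \<in> regular_graphs n d. 2 * s \<le> Y E}) \<le> real (card (regular_graphs n d))"
proof -
  let ?S = "regular_graphs n d"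
  let ?A = "{E \<in> ?S. s \<le> Y E}"
  let ?B = "real (n * (ball_bound d K * (d * d))) * 2 ^ switching_change d K"
  let ?F = "real (s * ((n - ball_bound d (K + 3)) * d))"
  let ?w = "\<lambda>X. \<Sum>E\<in>X. (2 :: real) ^ Y E"
  have "2 * (n * (ball_bound d K * d)) * 2 ^ switching_change d K * d
      \<le> s * (n - ball_bound d (K + 3)) * d"
    using large by (intro mult_right_mono) auto
  then have "real (2 * (n * (ball_bound d K * d)) * 2 ^ switching_change d K * d)
      \<le> real (s * (n - ball_bound d (K + 3)) * d)"
    by (rule of_nat_mono)
  then have BF: "2 * ?B \<le> ?F" by (simp add: mult_ac)
  have F: "?F > 0" using pos by (simp only: mult.assoc of_nat_0_less_iff)
  have fin: "finite ?S" by (rule finite_regular_graphs)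
  have split: "?w ?S = ?w ?A + ?w (?S - ?A)"
    using fin by (subst add.commute, intro sum.subset_diff) auto
  have w0: "?w ?S \<ge> 0" by (intro sum_nonneg) auto
  have "?w ?A * ?F \<le> ?B * ?w ?S"
    using switching_double_count[where n = n and d = d and s = s and K = K] unfolding Y_def .
  also have "\<dots> \<le> ?F / 2 * ?w ?S" using BF w0 by (intro mult_right_mono) auto
  finally have "?w ?A * ?F \<le> (?w ?S / 2) * ?F" by (simp add: mult_ac)
  then have "?w ?A \<le> ?w ?S / 2" using F by (rule mult_right_le_imp_le)
  then have "?w ?A \<le> ?w (?S - ?A)" using split by linarith
  also have "\<dots> \<le> (\<Sum>E\<in>?S - ?A. 2 ^ s)"
    by (intro sum_mono power_increasing) auto
  also have "\<dots> \<le> real (card ?S) * 2 ^ s"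
    using fin by (auto intro!: card_mono)
  finally have upper: "?w ?A \<le> real (card ?S) * 2 ^ s" .
  let ?T = "{E \<in> ?S. 2 * s \<le> Y E}"
  \<comment> \<open>Markov's inequality: every graph in \<open>?T\<close> has weight at least
    \<open>2 ^ (2 * s)\<close>.\<close>
  have "real (card ?T) * 2 ^ (2 * s) = (\<Sum>E\<in>?T. 2 ^ (2 * s))" by simp
  also have "\<dots> \<le> ?w ?T" by (intro sum_mono power_increasing) auto
  also have "\<dots> \<le> ?w ?A" using fin by (intro sum_mono2) auto
  also note upper
  finally have "real (card ?T) * 2 ^ (2 * s) \<le> real (card ?S) * 2 ^ s" .
  moreover have "real (card ?T) * 2 ^ (2 * s) = 2 ^ s * real (card ?T) * 2 ^ s"
    unfolding mult_2 power_add by (simp only: mult_ac)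
  ultimately have "2 ^ s * real (card ?T) * 2 ^ s \<le> real (card ?S) * 2 ^ s" by simp
  then show ?thesis by (rule mult_right_le_imp_le) simp
qed

lemma short_cycle_edges_exponential_tail:
  fixes \<delta> :: real
  assumes "d > 0" "\<delta> > 0"
  shows "\<exists>C c :: real. C > 0 \<and> c > 0 \<and> (\<forall>n.
    real (card {E \<in> regular_graphs n d. \<delta> * real n < real (card (short_cycle_edges K E))})
      \<le> C * exp (- c * real n) * real (card (regular_graphs n d)))"
proof -
  \<comment> \<open>Chosen so that hypothesis \<open>large\<close> of the tail bound reads
    \<open>M * n / 2 \<le> s * (n - ball_bound d (K + 3))\<close>. Beyond \<open>n0\<close> the
    second factor is at least \<open>n / 2\<close> and \<open>s\<close> exceeds
    \<open>M\<close>.\<close>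
  define M where "M = 4 * real (ball_bound d K * d) * 2 ^ switching_change d K"
  define n0 where "n0 = max (2 * real (ball_bound d (K + 3)) + 1) (2 * (M + 2) / \<delta>)"
  define c where "c = \<delta> * ln 2 / 2"
  \<comment> \<open>The exponential makes the claim trivial below \<open>n0\<close>; the
    \<open>2\<close> pays for rounding \<open>s\<close> down.\<close>
  define C where "C = max 2 (exp (c * n0))"
  have c: "c > 0" using assms unfolding c_def by simp
  have "real (card {E \<in> regular_graphs n d. \<delta> * real n < real (card (short_cycle_edges K E))})
      \<le> C * exp (- c * real n) * real (card (regular_graphs n d))" for n
  proof (cases "real n < n0")
    case True
    have "exp (c * real n) \<le> C"
      using True c unfolding C_def by (intro max.coboundedI2) simp
    then have "1 \<le> C * exp (- c * real n)" by (simp add: exp_minus field_simps)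
    moreover have "card {E \<in> regular_graphs n d. \<delta> * real n < real (card (short_cycle_edges K E))}
        \<le> card (regular_graphs n d)"
      by (intro card_mono finite_regular_graphs) auto
    ultimately have "1 * real (card {E \<in> regular_graphs n d. \<delta> * real n < real (card (short_cycle_edges K E))})
        \<le> (C * exp (- c * real n)) * real (card (regular_graphs n d))"
      by (intro mult_mono) auto
    then show ?thesis by simp
  next
    case False
    \<comment> \<open>Rounding down gives \<open>2 * s \<le> \<delta> * n\<close>, so the event in
      question implies \<open>2 * s \<le> Y\<close>.\<close>
    define s where "s = nat \<lfloor>\<delta> * real n / 2\<rfloor>"
    have \<delta>n: "\<delta> * real n / 2 \<ge> M + 2"
    proof -
      have "2 * (M + 2) / \<delta> \<le> real n" using False unfolding n0_def by linarith
      then show ?thesis using assms by (simp add: pos_divide_le_eq mult.commute)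
    qed
    have s: "real s \<le> \<delta> * real n / 2" "real s > \<delta> * real n / 2 - 1"
    proof -
      have "\<delta> * real n / 2 \<ge> 0" using assms by simp
      then show "real s \<le> \<delta> * real n / 2" "real s > \<delta> * real n / 2 - 1"
        unfolding s_def by linarith+
    qed
    have M0: "M \<ge> 0" unfolding M_def by simp
    have n: "real n \<ge> 2 * real (ball_bound d (K + 3)) + 1" using False unfolding n0_def by simp
    then have half: "real n / 2 \<le> real (n - ball_bound d (K + 3))" by linarith
    have "M * (real n / 2) \<le> real s * real (n - ball_bound d (K + 3))"
      using s \<delta>n half M0 by (intro mult_mono) auto
    then have "real (2 * (n * (ball_bound d K * d)) * 2 ^ switching_change d K)
        \<le> real (s * (n - ball_bound d (K + 3)))"
      unfolding M_def by (simp add: mult_ac)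
    then have large: "2 * (n * (ball_bound d K * d)) * 2 ^ switching_change d K
        \<le> s * (n - ball_bound d (K + 3))"
      by (simp only: of_nat_le_iff)
    have "real s > 0" "real (n - ball_bound d (K + 3)) > 0" using s \<delta>n M0 half n by linarith+
    then have pos: "0 < s * (n - ball_bound d (K + 3)) * d" using assms by simp
    let ?T = "{E \<in> regular_graphs n d. 2 * s \<le> card (short_cycle_edges K E)}"
    have "card {E \<in> regular_graphs n d. \<delta> * real n < real (card (short_cycle_edges K E))} \<le> card ?T"
      using s(1) by (intro card_mono) (auto simp: finite_regular_graphs)
    then have le: "real (card {E \<in> regular_graphs n d. \<delta> * real n < real (card (short_cycle_edges K E))})
        \<le> real (card ?T)" by simp
    have "exp (c * real n) = 2 powr (\<delta> * real n / 2)"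
      unfolding c_def powr_def by (simp add: mult_ac)
    also have "\<dots> \<le> 2 powr (1 + real s)" using s by (intro powr_mono) auto
    also have "\<dots> = 2 * 2 ^ s" by (simp add: powr_add powr_realpow)
    also have "\<dots> \<le> C * 2 ^ s" unfolding C_def by (intro mult_right_mono) auto
    finally have "exp (c * real n) \<le> C * 2 ^ s" .
    then have "exp (c * real n) * real (card ?T) \<le> C * 2 ^ s * real (card ?T)"
      by (intro mult_right_mono) auto
    also have "\<dots> \<le> C * real (card (regular_graphs n d))"
      using short_cycle_edges_tail[OF large pos] unfolding mult.assoc C_def
      by (intro mult_left_mono) auto
    finally have "real (card ?T) \<le> C * exp (- c * real n) * real (card (regular_graphs n d))"
      by (simp add: exp_minus field_simps)
    then show ?thesis using le by linarith
  qed
  moreover have "C > 0" unfolding C_def by linarith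
  ultimately show ?thesis using c by blast
qed

section \<open>Correlations in symmetrically prepared states\<close>

text \<open>Basis vectors are identified with sets of qubits, so that a bipartition of the qubits
  splits an index \<open>I\<close> into \<open>I \<inter> S\<close> and
  \<open>I - S\<close>.\<close>

definition ones :: "nat \<Rightarrow> nat set" where
  "ones i = {v. bit i v}"

text \<open>The eigenvalue of \<open>Z\<close> at \<open>v\<close> on the basis vector
  \<open>I\<close>.\<close>

definition spin :: "nat \<Rightarrow> nat set \<Rightarrow> real" where
  "spin v I = (if v \<in> I then - 1 else 1)"

definition diag_op :: "nat \<Rightarrow> (nat set \<Rightarrow> real) \<Rightarrow> complex mat" where
  "diag_op n f = mat (2 ^ n) (2 ^ n) (\<lambda>(i, j). if i = j then of_real (f (ones i)) else 0)"

lemma ones_subset: "i < 2 ^ n \<Longrightarrow> ones i \<subseteq> {..<n}"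
proof
  fix v assume i: "i < 2 ^ n" and v: "v \<in> ones i"
  have "i div 2 ^ v \<noteq> 0" using v by (auto simp: ones_def bit_iff_odd dest: odd_pos)
  then have "(2 :: nat) ^ v \<le> i" by (simp add: div_eq_0_iff)
  then have "(2 :: nat) ^ v < 2 ^ n" using i by (rule le_less_trans)
  then show "v \<in> {..<n}" by simp
qed

lemma ones_eq_iff [simp]: "ones i = ones j \<longleftrightarrow> i = j"
  by (auto simp: ones_def bit_eq_iff)

lemma bij_betw_ones: "bij_betw ones {..<2 ^ n} (Pow {..<n})"
proof -
  have inj: "inj_on ones {..<2 ^ n}" by (simp add: inj_on_def)
  have "ones ` {..<2 ^ n} = Pow {..<n}"
    by (rule card_subset_eq) (use ones_subset in \<open>auto simp: card_image[OF inj] card_Pow\<close>)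
  then show ?thesis using inj by (simp add: bij_betw_def)
qed

lemma sum_ones: "(\<Sum>i<2 ^ n. f (ones i)) = (\<Sum>I\<in>Pow {..<n}. f I)"
  by (rule sum.reindex_bij_betw[OF bij_betw_ones])

lemma index_with_ones:
  assumes "I \<subseteq> {..<n}"
  obtains i where "i < 2 ^ n" "ones i = I"
  using bij_betw_ones[of n] assms unfolding bij_betw_def by (metis PowI imageE lessThan_iff)

lemma digit_eq: "digit i v = of_bool (v \<in> ones i)"
  by (simp add: digit_def ones_def)

lemma pauli_Z_carrier: "pauli_Z \<in> carrier_mat 2 2"
  by (rule carrier_matI) (simp_all add: pauli_Z_def mat_of_rows_list_def)

lemma pauli_Z_index: "pauli_Z $$ (of_bool P, of_bool Q) = (if P = Q then (if P then - 1 else 1) else 0)"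
  by (auto simp: pauli_Z_def mat_of_rows_list_def)

lemma pauli_X_index: "pauli_X $$ (of_bool P, of_bool Q) = of_bool (P \<noteq> Q)"
  by (auto simp: pauli_X_def mat_of_rows_list_def)

lemma diag_op_carrier [simp]: "diag_op n f \<in> carrier_mat (2 ^ n) (2 ^ n)"
  by (simp add: diag_op_def)

lemma on_qubit_pauli_Z:
  assumes "v < n"
  shows "on_qubit n v pauli_Z = diag_op n (spin v)"
proof (rule eq_matI)
  fix i j assume "i < dim_row (diag_op n (spin v))" "j < dim_col (diag_op n (spin v))"
  then have ij: "i < 2 ^ n" "j < 2 ^ n" by (simp_all add: diag_op_def)
  let ?f = "\<lambda>w. ((\<lambda>_. 1\<^sub>m 2)(v := pauli_Z)) w $$ (digit i w, digit j w)"
  have f: "?f w = of_bool (w \<in> ones i \<longleftrightarrow> w \<in> ones j) * (if w = v then of_real (spin v (ones i)) else 1)" for w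
    by (auto simp: digit_eq pauli_Z_index spin_def)
  have "(\<Prod>w<n. ?f w) = (if i = j then of_real (spin v (ones i)) else 0)"
  proof (cases "i = j")
    case True
    then have "(\<Prod>w<n. ?f w) = (\<Prod>w<n. if w = v then of_real (spin v (ones i)) else 1)"
      unfolding f by simp
    then show ?thesis using True assms by simp
  next
    case False
    then have "ones i \<noteq> ones j" by simp
    then obtain w where "(w \<in> ones i) \<noteq> (w \<in> ones j)" by blast
    then have "w < n" "?f w = 0"
      using ones_subset ij unfolding f by auto
    then have "(\<Prod>w<n. ?f w) = 0" by (intro prod_zero bexI[of _ w]) simp_all
    then show ?thesis using False by simp
  qed
  then show "on_qubit n v pauli_Z $$ (i, j) = diag_op n (spin v) $$ (i, j)"
    using ij by (simp add: on_qubit_def tensor_mat_def diag_op_def)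
qed (simp_all add: on_qubit_def tensor_mat_def diag_op_def)

text \<open>Flipping every qubit permutes the basis by complementation.\<close>

lemma global_X_index:
  assumes "i < 2 ^ n" "j < 2 ^ n"
  shows "global_X n $$ (i, j) = of_bool (ones j = {..<n} - ones i)"
proof -
  have "(\<Prod>v<n. pauli_X $$ (digit i v, digit j v)) = (\<Prod>v<n. of_bool ((v \<in> ones i) \<noteq> (v \<in> ones j)))"
    by (simp only: digit_eq pauli_X_index)
  also have "\<dots> = of_bool (\<forall>v<n. (v \<in> ones i) \<noteq> (v \<in> ones j))"
    by (auto intro!: prod_zero)
  also have "(\<forall>v<n. (v \<in> ones i) \<noteq> (v \<in> ones j)) \<longleftrightarrow> ones j = {..<n} - ones i"
    using ones_subset[OF assms(1)] ones_subset[OF assms(2)] by blast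
  finally show ?thesis using assms by (simp add: global_X_def tensor_mat_def)
qed

lemma mult_mat_vec_index:
  fixes A :: "complex mat"
  assumes "A \<in> carrier_mat N M" "x \<in> carrier_vec M" "i < N"
  shows "(A *\<^sub>v x) $ i = (\<Sum>j<M. A $$ (i, j) * x $ j)"
  using assms by (auto simp: scalar_prod_def lessThan_atLeast0 intro!: sum.cong)

lemma cscalar_prod_eq_sum:
  fixes x y :: "complex vec"
  assumes "x \<in> carrier_vec N" "y \<in> carrier_vec N"
  shows "x \<bullet>c y = (\<Sum>i<N. x $ i * cnj (y $ i))"
  using assms by (auto simp: scalar_prod_def lessThan_atLeast0 conjugate_complex_def intro!: sum.cong)

lemma mat_adjoint_carrier [simp]:
  "A \<in> carrier_mat N M \<Longrightarrow> mat_adjoint A \<in> carrier_mat M N"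
  by (auto simp: mat_adjoint_def mat_of_rows_def)

lemma mat_adjoint_index:
  fixes A :: "complex mat"
  assumes "A \<in> carrier_mat N M" "i < M" "j < N"
  shows "mat_adjoint A $$ (i, j) = cnj (A $$ (j, i))"
  using assms by (auto simp: mat_adjoint_def mat_of_rows_def conjugate_complex_def)

lemma mat_adjoint_cscalar_prod:
  fixes A :: "complex mat"
  assumes A: "A \<in> carrier_mat N M" and x: "x \<in> carrier_vec N" and y: "y \<in> carrier_vec M"
  shows "(mat_adjoint A *\<^sub>v x) \<bullet>c y = x \<bullet>c (A *\<^sub>v y)"
proof -
  have "(mat_adjoint A *\<^sub>v x) \<bullet>c y = (\<Sum>i<M. (\<Sum>j<N. mat_adjoint A $$ (i, j) * x $ j) * cnj (y $ i))"
    using assms by (subst cscalar_prod_eq_sum[of _ M]) (auto simp: mult_mat_vec_index[of _ M N] simp del: index_mult_mat_vec intro!: sum.cong mult_mat_vec_carrier)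
  also have "\<dots> = (\<Sum>i<M. \<Sum>j<N. cnj (A $$ (j, i)) * x $ j * cnj (y $ i))"
    using A by (auto simp: mat_adjoint_index sum_distrib_right intro!: sum.cong)
  also have "\<dots> = (\<Sum>j<N. x $ j * cnj (\<Sum>i<M. A $$ (j, i) * y $ i))"
    by (subst sum.swap) (simp add: sum_distrib_left mult_ac)
  also have "\<dots> = x \<bullet>c (A *\<^sub>v y)"
    using assms by (subst cscalar_prod_eq_sum[of _ N]) (auto simp: mult_mat_vec_index[of _ N M] simp del: index_mult_mat_vec intro!: sum.cong mult_mat_vec_carrier)
  finally show ?thesis .
qed

text \<open>The passage to the Heisenberg picture, in which the range of the circuit is
  expressed.\<close>

lemma expectation_value_conjugation:
  assumes U: "U \<in> carrier_mat (2 ^ n) (2 ^ n)" and A: "A \<in> carrier_mat (2 ^ n) (2 ^ n)"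
    and x: "x \<in> carrier_vec (2 ^ n)"
  shows "expectation_value (mat_adjoint U * A * U) x = expectation_value A (U *\<^sub>v x)"
proof -
  have "(mat_adjoint U * A * U) *\<^sub>v x = mat_adjoint U *\<^sub>v (A *\<^sub>v (U *\<^sub>v x))"
    using assms by (subst assoc_mult_mat_vec[of _ "2 ^ n" "2 ^ n" _ "2 ^ n"];
      (subst assoc_mult_mat_vec[of _ "2 ^ n" "2 ^ n" _ "2 ^ n"])?)
      (auto intro!: mult_carrier_mat[of _ "2 ^ n" "2 ^ n"])
  then show ?thesis
    using assms by (simp add: expectation_value_def mat_adjoint_cscalar_prod[of _ "2 ^ n" "2 ^ n"])
qed

lemma expectation_value_eq_sum:
  assumes "A \<in> carrier_mat (2 ^ n) (2 ^ n)" "x \<in> carrier_vec (2 ^ n)"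
  shows "expectation_value A x = (\<Sum>i<2 ^ n. \<Sum>j<2 ^ n. A $$ (i, j) * x $ j * cnj (x $ i))"
  unfolding expectation_value_def using assms
  by (subst cscalar_prod_eq_sum[of _ "2 ^ n"])
     (auto simp: mult_mat_vec_index[of _ "2 ^ n" "2 ^ n"] sum_distrib_right simp del: index_mult_mat_vec
       intro!: sum.cong mult_mat_vec_carrier)

text \<open>Diagonal observables are averages over the outcome of a measurement in the computational
  basis.\<close>

lemma expectation_value_diag_op:
  assumes "x \<in> carrier_vec (2 ^ n)"
  shows "expectation_value (diag_op n f) x = of_real (\<Sum>i<2 ^ n. f (ones i) * (cmod (x $ i))\<^sup>2)"
proof -
  have "expectation_value (diag_op n f) x
      = (\<Sum>i<2 ^ n. \<Sum>j<2 ^ n. diag_op n f $$ (i, j) * x $ j * cnj (x $ i))"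
    by (intro expectation_value_eq_sum assms) simp
  also have "\<dots> = (\<Sum>i<2 ^ n. \<Sum>j<2 ^ n. if i = j then of_real (f (ones i)) * x $ j * cnj (x $ i) else 0)"
    by (intro sum.cong refl) (auto simp: diag_op_def)
  also have "\<dots> = (\<Sum>i<2 ^ n. of_real (f (ones i)) * (x $ i * cnj (x $ i)))"
    by (simp add: mult.assoc)
  also have "\<dots> = of_real (\<Sum>i<2 ^ n. f (ones i) * (cmod (x $ i))\<^sup>2)"
    unfolding of_real_sum of_real_mult complex_norm_square ..
  finally show ?thesis .
qed

lemma diag_op_mult: "diag_op n f * diag_op n g = diag_op n (\<lambda>I. f I * g I)"
proof (rule eq_matI)
  fix i j assume "i < dim_row (diag_op n (\<lambda>I. f I * g I))" "j < dim_col (diag_op n (\<lambda>I. f I * g I))"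
  then have ij: "i < 2 ^ n" "j < 2 ^ n" by (simp_all add: diag_op_def)
  have "(diag_op n f * diag_op n g) $$ (i, j) = (\<Sum>k<2 ^ n. diag_op n f $$ (i, k) * diag_op n g $$ (k, j))"
    using ij by (simp add: diag_op_def scalar_prod_def lessThan_atLeast0)
  also have "\<dots> = (\<Sum>k<2 ^ n. if k = i then (if i = j then of_real (f (ones i) * g (ones i)) else 0) else 0)"
    using ij by (intro sum.cong) (auto simp: diag_op_def)
  finally show "(diag_op n f * diag_op n g) $$ (i, j) = diag_op n (\<lambda>I. f I * g I) $$ (i, j)"
    using ij by (simp add: diag_op_def)
qed (simp_all add: diag_op_def)

section \<open>Factorization of expectations in product states\<close>

definition amplitude :: "(nat \<Rightarrow> complex vec) \<Rightarrow> nat set \<Rightarrow> nat set \<Rightarrow> complex" where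
  "amplitude \<phi> S I = (\<Prod>v\<in>S. \<phi> v $ of_bool (v \<in> I))"

lemma tensor_vec_index: "i < 2 ^ n \<Longrightarrow> tensor_vec n \<phi> $ i = amplitude \<phi> {..<n} (ones i)"
  by (simp add: tensor_vec_def amplitude_def digit_eq)

lemma tensor_vec_carrier [simp]: "tensor_vec n \<phi> \<in> carrier_vec (2 ^ n)"
  by (simp add: tensor_vec_def)

lemma amplitude_norm:
  assumes "finite S" "\<And>v. v \<in> S \<Longrightarrow> \<phi> v \<in> carrier_vec 2 \<and> \<phi> v \<bullet>c \<phi> v = 1"
  shows "(\<Sum>P\<in>Pow S. amplitude \<phi> S P * cnj (amplitude \<phi> S P)) = 1"
proof -
  let ?p = "\<lambda>k v. \<phi> v $ k * cnj (\<phi> v $ k)"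
  have "amplitude \<phi> S P * cnj (amplitude \<phi> S P) = prod (?p 1) P * prod (?p 0) (S - P)"
    if "P \<in> Pow S" for P
  proof -
    have "amplitude \<phi> S P * cnj (amplitude \<phi> S P) = (\<Prod>v\<in>S. if v \<in> P then ?p 1 v else ?p 0 v)"
      unfolding amplitude_def cnj_prod prod.distrib[symmetric] by (intro prod.cong) auto
    also have "\<dots> = prod (?p 1) (S \<inter> {v. v \<in> P}) * prod (?p 0) (S \<inter> - {v. v \<in> P})"
      by (rule prod.If_cases) fact
    also have "S \<inter> {v. v \<in> P} = P" using that by auto
    also have "S \<inter> - {v. v \<in> P} = S - P" by auto
    finally show ?thesis .
  qed
  then have "(\<Sum>P\<in>Pow S. amplitude \<phi> S P * cnj (amplitude \<phi> S P))
      = (\<Sum>P\<in>Pow S. prod (?p 1) P * prod (?p 0) (S - P))"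
    by (intro sum.cong) auto
  \<comment> \<open>The product of sums, expanded: \<open>P\<close> records the factors from which
    the first summand is taken.\<close>
  also have "\<dots> = (\<Prod>v\<in>S. ?p 1 v + ?p 0 v)"
    using assms(1) by (intro prod_add[symmetric])
  also have "\<dots> = 1"
  proof (rule prod.neutral, rule ballI)
    fix v assume "v \<in> S"
    then have "(\<Sum>k<2. \<phi> v $ k * cnj (\<phi> v $ k)) = 1"
      using assms(2) cscalar_prod_eq_sum[of "\<phi> v" 2 "\<phi> v"] by auto
    then show "?p 1 v + ?p 0 v = 1" by (simp add: numeral_2_eq_2 add.commute)
  qed
  finally show ?thesis .
qed

lemma sum_Pow_split:
  assumes "S \<subseteq> N"
  shows "(\<Sum>I\<in>Pow N. f (I \<inter> S) (I - S)) = (\<Sum>P\<in>Pow S. \<Sum>Q\<in>Pow (N - S). f P Q)"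
proof -
  have "(\<Sum>I\<in>Pow N. f (I \<inter> S) (I - S)) = (\<Sum>(P, Q)\<in>Pow S \<times> Pow (N - S). f P Q)"
    by (rule sum.reindex_bij_witness[of _ "\<lambda>(P, Q). P \<union> Q" "\<lambda>I. (I \<inter> S, I - S)"])
       (use assms in \<open>auto simp: Int_Un_distrib2 Un_Diff\<close>)
  then show ?thesis by (simp add: sum.cartesian_product)
qed

lemma amplitude_split:
  assumes "S \<subseteq> {..<n}"
  shows "amplitude \<phi> {..<n} I = amplitude \<phi> S (I \<inter> S) * amplitude \<phi> ({..<n} - S) (I - S)"
proof -
  have "amplitude \<phi> {..<n} I = amplitude \<phi> ({..<n} - S) I * amplitude \<phi> S I"
    unfolding amplitude_def by (rule prod.subset_diff[OF assms]) simp
  also have "amplitude \<phi> ({..<n} - S) I = amplitude \<phi> ({..<n} - S) (I - S)"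
    unfolding amplitude_def by (intro prod.cong) auto
  also have "amplitude \<phi> S I = amplitude \<phi> S (I \<inter> S)"
    unfolding amplitude_def by (intro prod.cong) auto
  finally show ?thesis by (simp add: mult.commute)
qed

text \<open>The matrix of an elementary tensor of \<open>a\<close> on \<open>S\<close> and
  \<open>b\<close> on the other qubits.\<close>

definition bipartite_op ::
    "nat \<Rightarrow> complex mat \<Rightarrow> nat set \<Rightarrow> (nat set \<Rightarrow> nat set \<Rightarrow> complex) \<Rightarrow> (nat set \<Rightarrow> nat set \<Rightarrow> complex) \<Rightarrow> bool" where
  "bipartite_op n A S a b \<longleftrightarrow> A \<in> carrier_mat (2 ^ n) (2 ^ n) \<and> (\<forall>i<2 ^ n. \<forall>j<2 ^ n.
    A $$ (i, j) = a (ones i \<inter> S) (ones j \<inter> S) * b (ones i - S) (ones j - S))"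

text \<open>The expectation of \<open>a\<close> in the part of the product state that lives on
  \<open>S\<close>.\<close>

definition local_expectation ::
    "(nat \<Rightarrow> complex vec) \<Rightarrow> nat set \<Rightarrow> (nat set \<Rightarrow> nat set \<Rightarrow> complex) \<Rightarrow> complex" where
  "local_expectation \<phi> S a =
    (\<Sum>P\<in>Pow S. \<Sum>P'\<in>Pow S. a P P' * amplitude \<phi> S P' * cnj (amplitude \<phi> S P))"

lemma expectation_bipartite_op:
  assumes S: "S \<subseteq> {..<n}" and A: "bipartite_op n A S a b"
  shows "expectation_value A (tensor_vec n \<phi>)
    = local_expectation \<phi> S a * local_expectation \<phi> ({..<n} - S) b"
proof -
  let ?N = "{..<n}" and ?T = "{..<n} - S"
  let ?\<alpha> = "amplitude \<phi> S" and ?\<beta> = "amplitude \<phi> ({..<n} - S)"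
  let ?x = "\<lambda>P P'. a P P' * ?\<alpha> P' * cnj (?\<alpha> P)" and ?y = "\<lambda>Q Q'. b Q Q' * ?\<beta> Q' * cnj (?\<beta> Q)"
  have "expectation_value A (tensor_vec n \<phi>) =
      (\<Sum>i<2 ^ n. \<Sum>j<2 ^ n. A $$ (i, j) * tensor_vec n \<phi> $ j * cnj (tensor_vec n \<phi> $ i))"
    using A by (intro expectation_value_eq_sum) (auto simp: bipartite_op_def)
  also have "\<dots> = (\<Sum>i<2 ^ n. \<Sum>j<2 ^ n. ?x (ones i \<inter> S) (ones j \<inter> S) * ?y (ones i - S) (ones j - S))"
    using A S by (intro sum.cong)
      (auto simp: bipartite_op_def tensor_vec_index amplitude_split mult_ac)
  also have "\<dots> = (\<Sum>I\<in>Pow ?N. \<Sum>J\<in>Pow ?N. ?x (I \<inter> S) (J \<inter> S) * ?y (I - S) (J - S))"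
    unfolding sum_ones[symmetric] ..
  also have "\<dots> = (\<Sum>P\<in>Pow S. \<Sum>Q\<in>Pow ?T. \<Sum>P'\<in>Pow S. \<Sum>Q'\<in>Pow ?T. ?x P P' * ?y Q Q')"
    unfolding sum_Pow_split[OF S, of "\<lambda>P' Q'. ?x (I \<inter> S) P' * ?y (I - S) Q'" for I]
      sum_Pow_split[OF S, of "\<lambda>P Q. \<Sum>P'\<in>Pow S. \<Sum>Q'\<in>Pow ?T. ?x P P' * ?y Q Q'"] ..
  also have "\<dots> = local_expectation \<phi> S a * local_expectation \<phi> ?T b"
    unfolding local_expectation_def sum_product ..
  finally show ?thesis .
qed

lemma local_expectation_identity:
  assumes "finite S" "\<And>v. v \<in> S \<Longrightarrow> \<phi> v \<in> carrier_vec 2 \<and> \<phi> v \<bullet>c \<phi> v = 1"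
  shows "local_expectation \<phi> S (\<lambda>P P'. of_bool (P = P')) = 1"
proof -
  have "local_expectation \<phi> S (\<lambda>P P'. of_bool (P = P'))
      = (\<Sum>P\<in>Pow S. \<Sum>P'\<in>Pow S. if P = P' then amplitude \<phi> S P' * cnj (amplitude \<phi> S P) else 0)"
    unfolding local_expectation_def by (intro sum.cong) auto
  also have "\<dots> = (\<Sum>P\<in>Pow S. amplitude \<phi> S P * cnj (amplitude \<phi> S P))"
    using assms(1) by (intro sum.cong) (auto simp: sum.delta)
  finally show ?thesis using amplitude_norm[OF assms] by simp
qed

text \<open>An operator on \<open>S\<close> times an operator on the other qubits is their tensor
  product: the two identities act as Kronecker deltas that leave a single intermediate
  index.\<close>

lemma bipartite_op_mult:
  assumes S: "S \<subseteq> {..<n}"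
    and A: "bipartite_op n A S a (\<lambda>Q Q'. of_bool (Q = Q'))"
    and B: "bipartite_op n B S (\<lambda>P P'. of_bool (P = P')) b"
  shows "bipartite_op n (A * B) S a b"
proof -
  let ?N = "{..<n}" and ?T = "{..<n} - S"
  have car: "A \<in> carrier_mat (2 ^ n) (2 ^ n)" "B \<in> carrier_mat (2 ^ n) (2 ^ n)"
    using A B by (auto simp: bipartite_op_def)
  have "(A * B) $$ (i, j) = a (ones i \<inter> S) (ones j \<inter> S) * b (ones i - S) (ones j - S)"
    if ij: "i < 2 ^ n" "j < 2 ^ n" for i j
  proof -
    have mem: "ones j \<inter> S \<in> Pow S" "ones i - S \<in> Pow ?T"
      using ones_subset[OF ij(1)] by auto
    have "(A * B) $$ (i, j) = (\<Sum>k<2 ^ n. A $$ (i, k) * B $$ (k, j))"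
      using car ij by (auto simp: scalar_prod_def lessThan_atLeast0 intro!: sum.cong)
    also have "\<dots> = (\<Sum>k<2 ^ n. (a (ones i \<inter> S) (ones k \<inter> S) * of_bool (ones i - S = ones k - S)) *
        (of_bool (ones k \<inter> S = ones j \<inter> S) * b (ones k - S) (ones j - S)))"
      using A B ij by (intro sum.cong) (auto simp: bipartite_op_def)
    also have "\<dots> = (\<Sum>K\<in>Pow ?N. (a (ones i \<inter> S) (K \<inter> S) * of_bool (ones i - S = K - S)) *
        (of_bool (K \<inter> S = ones j \<inter> S) * b (K - S) (ones j - S)))"
      by (rule sum_ones)
    also have "\<dots> = (\<Sum>P\<in>Pow S. \<Sum>Q\<in>Pow ?T. (a (ones i \<inter> S) P * of_bool (ones i - S = Q)) *
        (of_bool (P = ones j \<inter> S) * b Q (ones j - S)))"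
      by (rule sum_Pow_split[OF S])
    also have "\<dots> = (\<Sum>P\<in>Pow S. if P = ones j \<inter> S then a (ones i \<inter> S) P * b (ones i - S) (ones j - S) else 0)"
    proof (intro sum.cong refl)
      fix P
      have "(\<Sum>Q\<in>Pow ?T. (a (ones i \<inter> S) P * of_bool (ones i - S = Q)) *
          (of_bool (P = ones j \<inter> S) * b Q (ones j - S))) =
        (\<Sum>Q\<in>Pow ?T. if ones i - S = Q then
          (if P = ones j \<inter> S then a (ones i \<inter> S) P * b Q (ones j - S) else 0) else 0)"
        by (intro sum.cong refl) auto
      also have "\<dots> = (if P = ones j \<inter> S then a (ones i \<inter> S) P * b (ones i - S) (ones j - S) else 0)"
        using mem finite_subset[OF S] by (subst sum.delta') auto
      finally show "(\<Sum>Q\<in>Pow ?T. (a (ones i \<inter> S) P * of_bool (ones i - S = Q)) *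
          (of_bool (P = ones j \<inter> S) * b Q (ones j - S))) =
        (if P = ones j \<inter> S then a (ones i \<inter> S) P * b (ones i - S) (ones j - S) else 0)" .
    qed
    also have "\<dots> = a (ones i \<inter> S) (ones j \<inter> S) * b (ones i - S) (ones j - S)"
      using mem finite_subset[OF S] by (subst sum.delta) auto
    finally show ?thesis .
  qed
  then show ?thesis using car by (simp add: bipartite_op_def)
qed

lemma supported_on_bipartite:
  assumes S: "S \<subseteq> {..<n}" and A: "supported_on n A S"
  obtains a where "bipartite_op n A S a (\<lambda>Q Q'. of_bool (Q = Q'))"
proof -
  obtain a where car: "A \<in> carrier_mat (2 ^ n) (2 ^ n)"
    and a: "\<And>i j. i < 2 ^ n \<Longrightarrow> j < 2 ^ n \<Longrightarrow> A $$ (i, j) =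
          a {v \<in> S. bit i v} {v \<in> S. bit j v} * of_bool (\<forall>v \<in> {..<n} - S. bit i v = bit j v)"
    using A unfolding supported_on_def by auto
  have "{v \<in> S. bit i v} = ones i \<inter> S" for i by (auto simp: ones_def)
  moreover have "(\<forall>v \<in> {..<n} - S. bit i v = bit j v) \<longleftrightarrow> ones i - S = ones j - S"
    if "i < 2 ^ n" "j < 2 ^ n" for i j
  proof -
    have "bit k v = (v \<in> ones k)" for k v by (simp add: ones_def)
    then show ?thesis using ones_subset[OF that(1)] ones_subset[OF that(2)] by auto
  qed
  ultimately have "bipartite_op n A S a (\<lambda>Q Q'. of_bool (Q = Q'))"
    using car a by (simp add: bipartite_op_def)
  then show ?thesis by (rule that)
qed

text \<open>Since \<open>T\<close> avoids \<open>S\<close>, an operator supported on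
  \<open>T\<close> acts as the identity on \<open>S\<close>; on the other qubits it is
  \<open>a\<close> tensored with the identity outside \<open>T\<close>.\<close>

lemma bipartite_op_complement:
  assumes ST: "S \<inter> T = {}" and A: "bipartite_op n A T a (\<lambda>Q Q'. of_bool (Q = Q'))"
  shows "bipartite_op n A S (\<lambda>P P'. of_bool (P = P'))
    (\<lambda>Q Q'. a (Q \<inter> T) (Q' \<inter> T) * of_bool (Q - T = Q' - T))"
proof -
  have 1: "(I - S) \<inter> T = I \<inter> T" for I using ST by auto
  have 2: "I - T = J - T \<longleftrightarrow> I \<inter> S = J \<inter> S \<and> I - S - T = J - S - T" for I J :: "nat set"
    using ST by blast
  have "A $$ (i, j) = of_bool (ones i \<inter> S = ones j \<inter> S) *
      (a ((ones i - S) \<inter> T) ((ones j - S) \<inter> T) * of_bool (ones i - S - T = ones j - S - T))"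
    if "i < 2 ^ n" "j < 2 ^ n" for i j
  proof -
    have "A $$ (i, j) = a (ones i \<inter> T) (ones j \<inter> T) * of_bool (ones i - T = ones j - T)"
      using A that by (simp add: bipartite_op_def)
    then show ?thesis unfolding 1 2[of "ones i"] of_bool_conj by (simp only: mult_ac)
  qed
  then show ?thesis using A by (simp add: bipartite_op_def)
qed

text \<open>With respect to the cut along \<open>S\<close>, the operators are a tensor with the
  identity on one side each, and the identity has expectation \<open>1\<close> in the normalized
  factors.\<close>

lemma expectation_disjoint_supports:
  assumes S: "S \<subseteq> {..<n}" and T: "T \<subseteq> {..<n}" and ST: "S \<inter> T = {}"
    and A: "supported_on n A S" and B: "supported_on n B T"
    and \<phi>: "\<And>v. v < n \<Longrightarrow> \<phi> v \<in> carrier_vec 2 \<and> \<phi> v \<bullet>c \<phi> v = 1"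
  shows "expectation_value (A * B) (tensor_vec n \<phi>) =
    expectation_value A (tensor_vec n \<phi>) * expectation_value B (tensor_vec n \<phi>)"
proof -
  obtain a where a: "bipartite_op n A S a (\<lambda>Q Q'. of_bool (Q = Q'))"
    using supported_on_bipartite[OF S A] .
  obtain b0 where "bipartite_op n B T b0 (\<lambda>Q Q'. of_bool (Q = Q'))"
    using supported_on_bipartite[OF T B] .
  then obtain b where b: "bipartite_op n B S (\<lambda>P P'. of_bool (P = P')) b"
    using bipartite_op_complement[OF ST] by blast
  have "local_expectation \<phi> S (\<lambda>P P'. of_bool (P = P')) = 1"
    "local_expectation \<phi> ({..<n} - S) (\<lambda>P P'. of_bool (P = P')) = 1"
    using S \<phi> by (auto intro!: local_expectation_identity dest: finite_subset)
  then show ?thesis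
    using expectation_bipartite_op[OF S bipartite_op_mult[OF S a b], of \<phi>]
      expectation_bipartite_op[OF S a, of \<phi>] expectation_bipartite_op[OF S b, of \<phi>] by simp
qed

lemma cscalar_prod_unitary:
  assumes U: "is_unitary n U" and x: "x \<in> carrier_vec (2 ^ n)"
  shows "(U *\<^sub>v x) \<bullet>c (U *\<^sub>v x) = x \<bullet>c x"
proof -
  have car: "U \<in> carrier_mat (2 ^ n) (2 ^ n)" and UU: "mat_adjoint U * U = 1\<^sub>m (2 ^ n)"
    using U by (auto simp: is_unitary_def)
  have "(U *\<^sub>v x) \<bullet>c (U *\<^sub>v x) = (mat_adjoint U *\<^sub>v (U *\<^sub>v x)) \<bullet>c x"
    using car x by (subst mat_adjoint_cscalar_prod[OF car _ x]) auto
  also have "mat_adjoint U *\<^sub>v (U *\<^sub>v x) = (mat_adjoint U * U) *\<^sub>v x"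
    by (rule assoc_mult_mat_vec[symmetric, OF mat_adjoint_carrier[OF car] car x])
  finally show ?thesis using UU x by simp
qed

lemma product_state_norm:
  assumes "is_product_state n x"
  shows "x \<bullet>c x = 1"
proof -
  obtain \<phi> where \<phi>: "\<And>v. v < n \<Longrightarrow> \<phi> v \<in> carrier_vec 2 \<and> \<phi> v \<bullet>c \<phi> v = 1"
    and x: "x = tensor_vec n \<phi>"
    using assms unfolding is_product_state_def by blast
  have "x \<bullet>c x = (\<Sum>i<2 ^ n. amplitude \<phi> {..<n} (ones i) * cnj (amplitude \<phi> {..<n} (ones i)))"
    unfolding x by (subst cscalar_prod_eq_sum[of _ "2 ^ n"]) (auto simp: tensor_vec_index)
  also have "\<dots> = 1"
    using \<phi> by (subst sum_ones) (auto intro!: amplitude_norm)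
  finally show ?thesis .
qed

section \<open>Spins and correlations in a prepared state\<close>

locale symmetric_preparation =
  fixes n R :: nat and E :: "nat set set" and U :: "complex mat" and \<phi> :: "complex vec"
  assumes unitary: "is_unitary n U" and symmetric: "symmetric_unitary n U"
    and range: "has_range n E R U"
    and product: "is_product_state n \<phi>" and symmetric_input: "symmetric_state n \<phi>"
begin

definition "\<psi> = U *\<^sub>v \<phi>"

lemma U_carrier: "U \<in> carrier_mat (2 ^ n) (2 ^ n)"
  using unitary by (simp add: is_unitary_def)

lemma \<phi>_carrier: "\<phi> \<in> carrier_vec (2 ^ n)"
  using product unfolding is_product_state_def by auto

lemma \<psi>_carrier: "\<psi> \<in> carrier_vec (2 ^ n)"
  unfolding \<psi>_def using U_carrier \<phi>_carrier by (rule mult_mat_vec_carrier)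

definition weight :: "nat \<Rightarrow> real" where
  "weight i = (cmod (\<psi> $ i))\<^sup>2"

lemma weight_nonneg: "weight i \<ge> 0"
  by (simp add: weight_def)

lemma sum_weight: "(\<Sum>i<2 ^ n. weight i) = 1"
proof -
  have "\<psi> \<bullet>c \<psi> = 1"
    unfolding \<psi>_def using cscalar_prod_unitary[OF unitary \<phi>_carrier] product_state_norm[OF product] by simp
  moreover have "\<psi> \<bullet>c \<psi> = of_real (\<Sum>i<2 ^ n. weight i)"
    unfolding cscalar_prod_eq_sum[OF \<psi>_carrier \<psi>_carrier] of_real_sum weight_def complex_norm_square ..
  ultimately show ?thesis by (metis of_real_eq_1_iff)
qed

lemma expectation_diag: "expectation_value (diag_op n f) \<psi> = of_real (\<Sum>i<2 ^ n. f (ones i) * weight i)"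
  unfolding weight_def by (rule expectation_value_diag_op[OF \<psi>_carrier])

lemma global_X_\<psi>: "global_X n *\<^sub>v \<psi> = \<psi>"
proof -
  have X: "global_X n \<in> carrier_mat (2 ^ n) (2 ^ n)"
    by (simp add: global_X_def tensor_mat_def)
  have "global_X n *\<^sub>v \<psi> = global_X n *\<^sub>v (U *\<^sub>v (global_X n *\<^sub>v \<phi>))"
    using symmetric_input by (simp add: \<psi>_def symmetric_state_def)
  also have "\<dots> = global_X n *\<^sub>v ((U * global_X n) *\<^sub>v \<phi>)"
    by (simp only: assoc_mult_mat_vec[OF U_carrier X \<phi>_carrier])
  also have "\<dots> = (global_X n * (U * global_X n)) *\<^sub>v \<phi>"
    by (rule assoc_mult_mat_vec[OF X mult_carrier_mat[OF U_carrier X] \<phi>_carrier, symmetric])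
  also have "global_X n * (U * global_X n) = U"
    using symmetric assoc_mult_mat[OF X U_carrier X] by (simp add: symmetric_unitary_def)
  finally show ?thesis by (simp add: \<psi>_def)
qed

lemma \<psi>_flip:
  assumes "i < 2 ^ n" "j < 2 ^ n" "ones j = {..<n} - ones i"
  shows "\<psi> $ i = \<psi> $ j"
proof -
  have X: "global_X n \<in> carrier_mat (2 ^ n) (2 ^ n)"
    by (simp add: global_X_def tensor_mat_def)
  have "\<psi> $ i = (global_X n *\<^sub>v \<psi>) $ i" by (simp only: global_X_\<psi>)
  also have "\<dots> = (\<Sum>k<2 ^ n. global_X n $$ (i, k) * \<psi> $ k)"
    by (rule mult_mat_vec_index[OF X \<psi>_carrier assms(1)])
  also have "\<dots> = (\<Sum>k<2 ^ n. if k = j then \<psi> $ k else 0)"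
    using assms by (intro sum.cong refl) (auto simp: global_X_index simp flip: assms(3))
  also have "\<dots> = \<psi> $ j" using assms by simp
  finally show ?thesis .
qed

text \<open>Complementing a configuration keeps its probability by symmetry and reverses the spin,
  so the mean equals its own negative.\<close>

lemma expectation_spin:
  assumes "v < n"
  shows "expectation_value (diag_op n (spin v)) \<psi> = 0"
proof -
  \<comment> \<open>The index of the complementary configuration, unique because \<open>ones\<close>
    is injective.\<close>
  define c where "c i = (THE j. ones j = {..<n} - ones i)" for i
  have c: "c i < 2 ^ n \<and> ones (c i) = {..<n} - ones i" for i
  proof -
    obtain j where j: "j < 2 ^ n" "ones j = {..<n} - ones i"
      using index_with_ones[of "{..<n} - ones i" n] by auto
    have "c i = j" unfolding c_def
    proof (rule the_equality)
      fix k assume "ones k = {..<n} - ones i"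
      then have "ones k = ones j" using j(2) by simp
      then show "k = j" by simp
    qed (rule j(2))
    then show ?thesis using j by simp
  qed
  have cc: "c (c i) = i" if "i < 2 ^ n" for i
  proof -
    have "ones (c (c i)) = ones i" using c ones_subset[OF that] by auto
    then show ?thesis by simp
  qed
  let ?s = "\<Sum>i<2 ^ n. spin v (ones i) * weight i"
  have "?s = (\<Sum>i<2 ^ n. spin v (ones (c i)) * weight (c i))"
    by (rule sum.reindex_bij_witness[of _ c c]) (auto simp: c cc)
  also have "\<dots> = (\<Sum>i<2 ^ n. - (spin v (ones i) * weight i))"
  proof (intro sum.cong refl)
    fix i assume "i \<in> {..<(2 :: nat) ^ n}"
    then have "weight (c i) = weight i" using \<psi>_flip[of i "c i"] c by (simp add: weight_def)
    moreover have "spin v (ones (c i)) = - spin v (ones i)" using c assms by (simp add: spin_def)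
    ultimately show "spin v (ones (c i)) * weight (c i) = - (spin v (ones i) * weight i)" by simp
  qed
  also have "\<dots> = - ?s" by (rule sum_negf)
  finally have "?s = 0" by simp
  then show ?thesis unfolding expectation_diag by simp
qed

abbreviation "correlation u v \<equiv> expectation_value (diag_op n (\<lambda>I. spin u I * spin v I)) \<psi>"

text \<open>The two evolved \<open>Z\<close> operators are supported on the balls, so the
  correlation is the product of two single-spin expectations, both \<open>0\<close>.\<close>

lemma correlation_disjoint_balls:
  assumes uv: "u < n" "v < n" and disjoint: "graph_ball n E u R \<inter> graph_ball n E v R = {}"
  shows "correlation u v = 0"
proof -
  let ?A = "\<lambda>w. mat_adjoint U * diag_op n (spin w) * U"
  obtain \<phi>s where \<phi>s: "\<And>w. w < n \<Longrightarrow> \<phi>s w \<in> carrier_vec 2 \<and> \<phi>s w \<bullet>c \<phi>s w = 1"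
    and \<phi>_eq: "\<phi> = tensor_vec n \<phi>s"
    using product unfolding is_product_state_def by blast
  have "mat_adjoint pauli_Z = pauli_Z"
  proof (rule eq_matI)
    fix i j assume "i < dim_row pauli_Z" "j < dim_col pauli_Z"
    then have "i < 2" "j < 2" using pauli_Z_carrier by auto
    then have "mat_adjoint pauli_Z $$ (i, j) = cnj (pauli_Z $$ (j, i))"
      by (intro mat_adjoint_index[OF pauli_Z_carrier])
    then show "mat_adjoint pauli_Z $$ (i, j) = pauli_Z $$ (i, j)"
      using \<open>i < 2\<close> \<open>j < 2\<close>
      by (auto simp: pauli_Z_def mat_of_rows_list_def numeral_2_eq_2 less_Suc_eq)
  qed (simp_all only: carrier_matD[OF mat_adjoint_carrier[OF pauli_Z_carrier]] carrier_matD[OF pauli_Z_carrier])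
  then have obs: "is_qubit_observable pauli_Z"
    using pauli_Z_carrier by (simp add: is_qubit_observable_def)
  have supp: "supported_on n (?A w) (graph_ball n E w R)" if "w < n" for w
    using range obs that on_qubit_pauli_Z[OF that] unfolding has_range_def by metis
  have ball: "graph_ball n E w R \<subseteq> {..<n}" for w by (auto simp: graph_ball_def)
  have single: "expectation_value (?A w) \<phi> = 0" if "w < n" for w
    using expectation_value_conjugation[OF U_carrier diag_op_carrier \<phi>_carrier]
      expectation_spin[OF that] by (simp add: \<psi>_def)
  \<comment> \<open>The inner \<open>U * mat_adjoint U\<close> cancels, so the product of the
    evolved operators is the evolved product.\<close>
  have "?A u * ?A v = mat_adjoint U * (diag_op n (spin u) * diag_op n (spin v)) * U"
  proof -
    let ?U = "mat_adjoint U" and ?Y = "diag_op n (spin u)" and ?Z = "diag_op n (spin v)"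
    let ?N = "(2 :: nat) ^ n"
    have car: "?U \<in> carrier_mat ?N ?N" "?Y \<in> carrier_mat ?N ?N" "?Z \<in> carrier_mat ?N ?N" "U \<in> carrier_mat ?N ?N"
      using U_carrier by auto
    have UU: "U * ?U = 1\<^sub>m ?N" using unitary by (simp add: is_unitary_def)
    note m = mult_carrier_mat[of _ ?N ?N _ ?N] and as = assoc_mult_mat[of _ ?N ?N _ ?N _ ?N]
    have "(?U * ?Y * U) * (?U * ?Z * U) = (?U * ?Y) * (U * (?U * ?Z * U))"
      by (rule as) (intro m car)+
    also have "U * (?U * ?Z * U) = U * (?U * (?Z * U))"
      by (subst as[of ?U ?Z U]) (intro m car refl)+
    also have "\<dots> = (U * ?U) * (?Z * U)"
      by (rule as[symmetric]) (intro m car)+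
    also have "\<dots> = ?Z * U" unfolding UU by (rule left_mult_one_mat[of _ ?N ?N]) (intro m car)
    also have "(?U * ?Y) * (?Z * U) = (?U * ?Y * ?Z) * U"
      by (rule as[symmetric]) (intro m car)+
    also have "?U * ?Y * ?Z = ?U * (?Y * ?Z)"
      by (rule as) (intro m car)+
    finally show ?thesis .
  qed
  then have "correlation u v = expectation_value (?A u * ?A v) \<phi>"
    using expectation_value_conjugation[OF U_carrier diag_op_carrier \<phi>_carrier]
    by (simp add: diag_op_mult \<psi>_def)
  also have "\<dots> = expectation_value (?A u) \<phi> * expectation_value (?A v) \<phi>"
    unfolding \<phi>_eq
    by (rule expectation_disjoint_supports[OF ball ball disjoint supp[OF uv(1)] supp[OF uv(2)] \<phi>s])
  finally show ?thesis using single uv by simp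
qed

text \<open>A variable with values \<open>1\<close> and \<open>- 1\<close> and mean
  \<open>- 1\<close> takes the value \<open>- 1\<close> wherever the probability is
  positive.\<close>

lemma anticorrelated_support:
  assumes "correlation u v = - 1" "i < 2 ^ n" "\<psi> $ i \<noteq> 0"
  shows "spin u (ones i) * spin v (ones i) = - 1"
proof -
  let ?s = "\<lambda>i. spin u (ones i) * spin v (ones i)"
  have "(\<Sum>i<2 ^ n. ?s i * weight i) = - 1"
    using assms(1) unfolding expectation_diag by (metis of_real_eq_iff of_real_minus of_real_1)
  then have "(\<Sum>i<2 ^ n. (1 + ?s i) * weight i) = 0"
    using sum_weight by (simp add: distrib_right sum.distrib)
  moreover have "0 \<le> (1 + ?s i) * weight i" for i
    using weight_nonneg[of i] by (auto simp: spin_def)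
  ultimately have "(1 + ?s i) * weight i = 0"
    using assms(2) by (subst (asm) sum_nonneg_eq_0_iff) auto
  moreover have "weight i \<noteq> 0" using assms(3) by (simp add: weight_def)
  ultimately show ?thesis by simp
qed

lemma correlation_of_constant:
  assumes "\<And>i. i < 2 ^ n \<Longrightarrow> \<psi> $ i \<noteq> 0 \<Longrightarrow> spin u (ones i) * spin v (ones i) = \<sigma>"
  shows "correlation u v = of_real \<sigma>"
proof -
  have "(\<Sum>i<2 ^ n. (spin u (ones i) * spin v (ones i)) * weight i) = (\<Sum>i<2 ^ n. \<sigma> * weight i)"
    using assms by (intro sum.cong refl) (auto simp: weight_def)
  then show ?thesis unfolding expectation_diag by (simp add: sum_distrib_left[symmetric] sum_weight)
qed

text \<open>Perfect anticorrelation propagates along \<open>F\<close>, so vertices of one component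
  have correlation \<open>1\<close> or \<open>- 1\<close>. As this is not \<open>0\<close>, their
  light cones meet, and they are at distance at most \<open>R + R\<close>.\<close>

lemma anticorrelated_component:
  assumes F: "\<And>x y. {x, y} \<in> F \<Longrightarrow> x < n \<and> y < n \<and> correlation x y = - 1"
    and uv: "(u, v) \<in> (adjacency F)\<^sup>*"
  shows "v \<in> reach E (R + R) u"
proof (cases "u = v")
  case False
  \<comment> \<open>The sign \<open>\<sigma>\<close> is the same on the whole support; each edge of
    \<open>F\<close> reverses it.\<close>
  have "\<exists>\<sigma>\<in>{1, - 1}. \<forall>i<2 ^ n. \<psi> $ i \<noteq> 0 \<longrightarrow> spin u (ones i) * spin v (ones i) = \<sigma>"
    using uv
  proof (induction rule: rtrancl_induct)
    case base
    then show ?case by (auto simp: spin_def)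
  next
    case (step x y)
    then obtain \<sigma> where \<sigma>: "\<sigma> \<in> {1, - 1}"
      "\<And>i. i < 2 ^ n \<Longrightarrow> \<psi> $ i \<noteq> 0 \<Longrightarrow> spin u (ones i) * spin x (ones i) = \<sigma>" by blast
    have "correlation x y = - 1" using step F by simp
    then have "spin u (ones i) * spin y (ones i) = - \<sigma>" if "i < 2 ^ n" "\<psi> $ i \<noteq> 0" for i
      using anticorrelated_support[of x y i] \<sigma>(2)[OF that] that
      by (auto simp: spin_def split: if_splits)
    then show ?case using \<sigma>(1) by (intro bexI[of _ "- \<sigma>"]) auto
  qed
  then obtain \<sigma> where \<sigma>: "\<sigma> \<in> {1, - 1}"
    "\<And>i. i < 2 ^ n \<Longrightarrow> \<psi> $ i \<noteq> 0 \<Longrightarrow> spin u (ones i) * spin v (ones i) = \<sigma>" by blast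
  have "correlation u v = of_real \<sigma>" by (rule correlation_of_constant[OF \<sigma>(2)])
  then have "correlation u v \<noteq> 0" using \<sigma>(1) by auto
  \<comment> \<open>As \<open>u\<close> and \<open>v\<close> differ, the walk has a first and a last
    edge, and ends of edges of \<open>F\<close> are below \<open>n\<close>.\<close>
  moreover have "u < n"
    using uv
  proof (cases rule: converse_rtranclE)
    case (step y)
    then show ?thesis using F by simp
  qed (use False in simp)
  moreover have "v < n"
    using uv
  proof (cases rule: rtranclE)
    case (step y)
    then show ?thesis using F by simp
  qed (use False in simp)
  ultimately obtain w where "w \<in> graph_ball n E u R" "w \<in> graph_ball n E v R"
    using correlation_disjoint_balls by blast
  moreover have "w \<in> reach E R x" if "w \<in> graph_ball n E x R" for x
  proof (rule ccontr)
    \<comment> \<open>Every walk then has more than \<open>R\<close> steps, and if there is none the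
      infimum is infinite.\<close>
    assume "w \<notin> reach E R x"
    then have "enat (Suc R) \<le> graph_dist E x w"
      unfolding graph_dist_def reach_def by (intro INF_greatest) (auto simp: not_le[symmetric] Suc_le_eq)
    also have "\<dots> \<le> enat R" using that by (simp add: graph_ball_def)
    finally show False by simp
  qed
  ultimately show ?thesis using reach_trans reach_sym by blast
qed simp

end

lemma edge_ZZ_eq:
  assumes "x < n" "y < n"
  shows "edge_ZZ n {x, y} = diag_op n (\<lambda>I. spin x I * spin y I)"
proof -
  have "edge_ZZ n {x, y} = diag_op n (spin (min x y)) * diag_op n (spin (max x y))"
    using assms by (simp add: edge_ZZ_def on_qubit_pauli_Z min_def max_def)
  then show ?thesis
    by (cases "x \<le> y") (simp_all add: diag_op_mult min_def max_def mult.commute)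
qed

lemma maxcut_hamiltonian_eq:
  assumes "\<And>e. e \<in> E \<Longrightarrow> edge_ZZ n e = diag_op n (f e)"
  shows "maxcut_hamiltonian n E = diag_op n (\<lambda>I. \<Sum>e\<in>E. (1 - f e I) / 2)"
proof (rule eq_matI)
  fix i j assume "i < dim_row (diag_op n (\<lambda>I. \<Sum>e\<in>E. (1 - f e I) / 2))"
    "j < dim_col (diag_op n (\<lambda>I. \<Sum>e\<in>E. (1 - f e I) / 2))"
  then have ij: "i < 2 ^ n" "j < 2 ^ n" by (simp_all add: diag_op_def)
  have "maxcut_hamiltonian n E $$ (i, j)
      = (\<Sum>e\<in>E. ((1 / 2) \<cdot>\<^sub>m (1\<^sub>m (2 ^ n) - edge_ZZ n e)) $$ (i, j))"
    using ij by (simp add: maxcut_hamiltonian_def)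
  also have "\<dots> = (\<Sum>e\<in>E. if i = j then of_real ((1 - f e (ones i)) / 2) else 0)"
    using ij assms by (intro sum.cong refl) (auto simp: diag_op_def)
  also have "\<dots> = diag_op n (\<lambda>I. \<Sum>e\<in>E. (1 - f e I) / 2) $$ (i, j)"
    using ij by (simp add: diag_op_def)
  finally show "maxcut_hamiltonian n E $$ (i, j) = diag_op n (\<lambda>I. \<Sum>e\<in>E. (1 - f e I) / 2) $$ (i, j)" .
qed (simp_all add: maxcut_hamiltonian_def diag_op_def)

section \<open>The energy bound\<close>

lemma regular_graphs_handshake:
  assumes E: "E \<in> regular_graphs n d"
  shows "2 * card E = n * d"
proof -
  have "2 * card E = (\<Sum>e\<in>E. card e)"
    using regular_graphsD(3)[OF E] by simp
  also have "\<dots> = (\<Sum>e\<in>E. \<Sum>v<n. of_bool (v \<in> e))"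
  proof (intro sum.cong refl)
    fix e assume "e \<in> E"
    then have "{..<n} \<inter> {v. v \<in> e} = e" using regular_graphsD(2)[OF E] by auto
    then show "card e = (\<Sum>v<n. of_bool (v \<in> e))" by simp
  qed
  also have "\<dots> = (\<Sum>v<n. \<Sum>e\<in>E. of_bool (v \<in> e))" by (rule sum.swap)
  also have "\<dots> = (\<Sum>v<n. vertex_degree E v)"
    using regular_graphsD(1)[OF E] by (simp add: vertex_degree_def Int_def)
  also have "\<dots> = n * d" using regular_graphsD(4)[OF E] by simp
  finally show ?thesis .
qed

text \<open>An edge contributes \<open>1 / 2\<close> if its correlation is \<open>0\<close> and
  \<open>1\<close> if it is \<open>- 1\<close>, so the energy is half of
  \<open>card E + card F\<close>; the components of \<open>F\<close> are bounded by the light-cone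
  argument.\<close>

lemma maxcut_energy_le:
  assumes E: "E \<in> regular_graphs n d" and prepared: "symmetrically_prepared n E R \<psi>"
    and correlations: "\<forall>e\<in>E. expectation_value (edge_ZZ n e) \<psi> \<in> {0, - 1}"
  shows "Re (expectation_value (maxcut_hamiltonian n E) \<psi>)
    \<le> real (card E) / 2 + real (n + card (short_cycle_edges ((ball_bound d (R + R))\<^sup>2) E)) / 2"
proof -
  obtain U \<phi> where S: "symmetric_preparation n R E U \<phi>" and \<psi>: "\<psi> = U *\<^sub>v \<phi>"
    using prepared unfolding symmetrically_prepared_def symmetric_preparation_def by blast
  interpret S: symmetric_preparation n R E U \<phi> by (rule S)
  have \<psi>_eq: "\<psi> = S.\<psi>" unfolding \<psi> S.\<psi>_def ..
  define F where "F = {e \<in> E. expectation_value (edge_ZZ n e) \<psi> = - 1}"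
  let ?f = "\<lambda>e I. spin (Min e) I * spin (Max e) I"
  have finE: "finite E" by (rule regular_graphsD(1)[OF E])
  have F: "x < n \<and> y < n \<and> S.correlation x y = - 1" if "{x, y} \<in> F" for x y
  proof -
    have xy: "{x, y} \<in> E" "expectation_value (edge_ZZ n {x, y}) \<psi> = - 1"
      using that by (auto simp: F_def)
    then have "x < n" "y < n" using regular_graphs_edgeD[OF E] by auto
    then show ?thesis using xy edge_ZZ_eq \<psi>_eq by simp
  qed
  have cardF: "card F \<le> n + card (short_cycle_edges ((ball_bound d (R + R))\<^sup>2) E)"
  proof (rule card_le_of_bounded_components[OF E])
    show "F \<subseteq> E" by (auto simp: F_def)
    show "v \<in> reach E (R + R) u" if "(u, v) \<in> (adjacency F)\<^sup>*" for u v
      using F that by (rule S.anticorrelated_component)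
  qed
  have edge: "edge_ZZ n e = diag_op n (?f e)" if "e \<in> E" for e
  proof -
    have "finite e" "e \<noteq> {}" using regular_graphsD(3)[OF E that] by (auto intro: card_ge_0_finite)
    then have "Min e < n" "Max e < n"
      using regular_graphsD(2)[OF E that] Min_in Max_in by blast+
    then show ?thesis by (simp add: edge_ZZ_def on_qubit_pauli_Z diag_op_mult)
  qed
  have "Re (expectation_value (maxcut_hamiltonian n E) \<psi>) =
      (\<Sum>i<2 ^ n. (\<Sum>e\<in>E. (1 - ?f e (ones i)) / 2) * S.weight i)"
    using maxcut_hamiltonian_eq[of E n ?f, OF edge] unfolding \<psi>_eq by (simp add: S.expectation_diag)
  also have "\<dots> = (\<Sum>e\<in>E. \<Sum>i<2 ^ n. ((1 - ?f e (ones i)) / 2) * S.weight i)"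
    unfolding sum_distrib_right by (rule sum.swap)
  also have "\<dots> = (\<Sum>e\<in>E. (1 - (\<Sum>i<2 ^ n. ?f e (ones i) * S.weight i)) / 2)"
  proof (intro sum.cong refl)
    fix e
    have "(\<Sum>i<2 ^ n. ((1 - ?f e (ones i)) / 2) * S.weight i) =
        ((\<Sum>i<2 ^ n. S.weight i) - (\<Sum>i<2 ^ n. ?f e (ones i) * S.weight i)) / 2"
      unfolding sum_subtractf[symmetric] sum_divide_distrib
      by (intro sum.cong refl) (simp add: algebra_simps)
    then show "(\<Sum>i<2 ^ n. ((1 - ?f e (ones i)) / 2) * S.weight i) =
        (1 - (\<Sum>i<2 ^ n. ?f e (ones i) * S.weight i)) / 2"
      unfolding S.sum_weight .
  qed
  also have "\<dots> = (\<Sum>e\<in>E. (1 - Re (expectation_value (edge_ZZ n e) \<psi>)) / 2)"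
    by (intro sum.cong refl) (simp add: edge \<psi>_eq S.expectation_diag)
  also have "\<dots> = (\<Sum>e\<in>E. 1 / 2 + of_bool (e \<in> F) / 2)"
    using correlations by (intro sum.cong refl) (auto simp: F_def)
  also have "\<dots> = real (card E) / 2 + real (card F) / 2"
  proof -
    have "E \<inter> {e. e \<in> F} = F" by (auto simp: F_def)
    then show ?thesis using finE by (simp add: sum.distrib sum_divide_distrib[symmetric])
  qed
  also have "\<dots> \<le> real (card E) / 2 + real (n + card (short_cycle_edges ((ball_bound d (R + R))\<^sup>2) E)) / 2"
    using cardF by simp
  finally show ?thesis .
qed

theorem corollary42:
  fixes d R :: nat and \<epsilon> :: real
  assumes "d > 0" and "\<epsilon> > 0"
  shows "\<exists>C c :: real. C > 0 \<and> c > 0 \<and>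
    (\<forall>n. regular_graphs n d \<noteq> {} \<longrightarrow>
      measure_pmf.prob (random_regular_graph n d)
        {E. \<forall>\<psi>. symmetrically_prepared n E R \<psi> \<longrightarrow>
              (\<forall>e\<in>E. expectation_value (edge_ZZ n e) \<psi> \<in> {0, - 1}) \<longrightarrow>
              Re (expectation_value (maxcut_hamiltonian n E) \<psi>)
                \<le> real (card E) * (1 / 2 + 1 / real d + \<epsilon>)}
      \<ge> 1 - C * exp (- c * real n))"
proof -
  define K where "K = (ball_bound d (R + R))\<^sup>2"
  \<comment> \<open>As \<open>card E = n * d / 2\<close>, the forest term \<open>n / 2\<close> is
    \<open>card E / d\<close>, and \<open>\<delta> * n / 2\<close> is
    \<open>\<epsilon> * card E\<close>.\<close>
  define \<delta> where "\<delta> = \<epsilon> * real d"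
  have "\<delta> > 0" using assms by (simp add: \<delta>_def)
  then obtain C c :: real where Cc: "C > 0" "c > 0"
    and tail: "\<And>n. real (card {E \<in> regular_graphs n d. \<delta> * real n < real (card (short_cycle_edges K E))})
      \<le> C * exp (- c * real n) * real (card (regular_graphs n d))"
    using short_cycle_edges_exponential_tail[OF \<open>d > 0\<close>, of \<delta> K] by blast
  show ?thesis
  proof (intro exI conjI allI impI)
    fix n assume ne: "regular_graphs n d \<noteq> {}"
    let ?S = "regular_graphs n d"
    let ?B = "{E \<in> ?S. \<delta> * real n < real (card (short_cycle_edges K E))}"
    let ?G = "{E. \<forall>\<psi>. symmetrically_prepared n E R \<psi> \<longrightarrow>
              (\<forall>e\<in>E. expectation_value (edge_ZZ n e) \<psi> \<in> {0, - 1}) \<longrightarrow>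
              Re (expectation_value (maxcut_hamiltonian n E) \<psi>)
                \<le> real (card E) * (1 / 2 + 1 / real d + \<epsilon>)}"
    have fin: "finite ?S" by (rule finite_regular_graphs)
    \<comment> \<open>The probability enters only through the set \<open>?B\<close>: outside it the
      energy bound holds for all prepared states at once.\<close>
    have "E \<in> ?G" if E: "E \<in> ?S" "E \<notin> ?B" for E
    proof (intro CollectI allI impI)
      fix \<psi> assume \<psi>: "symmetrically_prepared n E R \<psi>"
        "\<forall>e\<in>E. expectation_value (edge_ZZ n e) \<psi> \<in> {0, - 1}"
      have "real (2 * card E) = real (n * d)" using regular_graphs_handshake[OF E(1)] by simp
      then have m: "real (card E) = real n * real d / 2" by simp
      have "Re (expectation_value (maxcut_hamiltonian n E) \<psi>)
          \<le> real (card E) / 2 + real (n + card (short_cycle_edges K E)) / 2"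
        using maxcut_energy_le[OF E(1) \<psi>] by (simp add: K_def)
      also have "\<dots> \<le> real (card E) / 2 + (real n + \<delta> * real n) / 2"
        using E by simp
      also have "\<dots> = real (card E) * (1 / 2 + 1 / real d + \<epsilon>)"
        using \<open>d > 0\<close> unfolding m \<delta>_def by (simp add: field_simps)
      finally show "Re (expectation_value (maxcut_hamiltonian n E) \<psi>)
          \<le> real (card E) * (1 / 2 + 1 / real d + \<epsilon>)" .
    qed
    then have "card (?S - ?B) \<le> card (?S \<inter> ?G)"
      using fin by (intro card_mono) auto
    moreover have "card (?S - ?B) = card ?S - card ?B"
      using fin by (intro card_Diff_subset) auto
    moreover have "card ?B \<le> card ?S" using fin by (intro card_mono) auto
    ultimately have "real (card ?S) - real (card ?B) \<le> real (card (?S \<inter> ?G))" by linarith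
    then have "(1 - C * exp (- c * real n)) * real (card ?S) \<le> real (card (?S \<inter> ?G))"
      using tail[of n] by (simp add: left_diff_distrib)
    \<comment> \<open>For a nonempty finite set, probabilities under the uniform law are quotients
      of cardinalities.\<close>
    moreover have "real (card ?S) > 0" using fin ne by (simp add: card_gt_0_iff)
    ultimately show "measure_pmf.prob (random_regular_graph n d) ?G \<ge> 1 - C * exp (- c * real n)"
      unfolding random_regular_graph_def measure_pmf_of_set[OF ne fin] by (simp add: pos_le_divide_eq)
  qed (use Cc in simp_all)
qed

end
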